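(* If $P_1,\ldots,P_m$ are special ample polytopes and $x\in\Lambda(P_1+\cdots+P_m)$, then: (i) There exists a tuple $(x_1,\ldots,x_m)\in\Lambda(P_1)\times\cdots\times\Lambda(P_m)$ such that $x_1+\cdots+x_m = x$; (ii) If $(x_1,\ldots,x_m)$ and $(x_1',\ldots,x_m')$ are two such tuples, then $(x_1,\ldots,x_m)\sim(x_1',\ldots,x_m')$.
   Context: Let $\Phi$ be an irreducible, reduced (finite, crystallographic) root system of rank $n$, with set of roots $\Delta$, root lattice $Y$, weight lattice $X \supseteq Y$, coroot lattice $X^\vee$, coweight lattice $Y^\vee$, and pairing $\langle\,,\rangle : X \times X^\vee \to \mathbb{Z}$ extended to $(X\otimes_{\mathbb Z}\mathbb{R})\times X^\vee$. Let $F_n$ be the set of Weyl chambers in $Y^\vee \otimes_{\mathbb Z} \mathbb{R}$. For $\sigma\in F_n$ let $\{\alpha_{i,\sigma} : 1\le i\le n\}$ be the corresponding simple roots; $x \in X\otimes_{\mathbb Z}\mathbb{R}$ is $\sigma$-dominant if $\langle x, \alpha_{i,\sigma}^\vee\rangle \ge 0$ for all $i$. For adjacent chambers $\sigma,\sigma'$, $\alpha_{\sigma,\sigma'}\in\Delta$ is the unique root positive on $\sigma$ and negative on $\sigma'$. An ample polytope is a convex polytope $P \subset X\otimes_{\mathbb Z}\mathbb{R}$ whose vertices are given by a set $\{\mu_\sigma : \sigma\in F_n\} \subset X$ such that for adjacent $\sigma,\sigma'$, $\mu_\sigma - \mu_{\sigma'} = r_{\sigma,\sigma'}\alpha_{\sigma,\sigma'}$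 with $r_{\sigma,\sigma'} \in \mathbb{Z}_{>0}$. It is special if $\mu_\sigma$ is $\sigma$-dominant for every $\sigma$. Put $\Lambda(P) := P \cap (\mu_\sigma + Y)$ (independent of $\sigma$). Sums of polytopes are Minkowski sums; $P_1+\cdots+P_m$ is again a special ample polytope, its vertex for $\sigma$ being the sum of those of the $P_i$. Root moves: suppose $(x_1,\ldots,x_m)\in\Lambda(P_1)\times\cdots\times\Lambda(P_m)$, $\beta\in\Delta$, and $i\ne j$ are indices such that $x_i+\beta\in\Lambda(P_i)$ and $x_j-\beta\in\Lambda(P_j)$. Then replacing $x_i$ by $x_i+\beta$ and $x_j$ by $x_j-\beta$ (all other entries unchanged) is called a root move. The relation $\sim$ on $\Lambda(P_1)\times\cdots\times\Lambda(P_m)$ is the equivalence relation generated by root moves. *)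

theory Defs
  imports "HOL-Analysis.Analysis" "HOL-Library.Set_Algebras" "HOL-Library.FuncSet"
begin

text \<open>
  The root system lives in a Euclidean space \<open>'a\<close>, which plays the role of \<open>X \<otimes> \<real>\<close>; its rank
  is \<open>DIM('a)\<close>. The inner product is required to be Weyl invariant and identifies the dual space
  \<open>Y\<^sup>\<or> \<otimes> \<real>\<close> with \<open>'a\<close>, so that the pairing is the inner product and coroots are vectors of \<open>'a\<close>.
\<close>

definition coroot :: "'a::euclidean_space \<Rightarrow> 'a" where
  "coroot \<alpha> = (2 / (\<alpha> \<bullet> \<alpha>)) *\<^sub>R \<alpha>"

definition root_reflection :: "'a::euclidean_space \<Rightarrow> 'a \<Rightarrow> 'a" where
  "root_reflection \<alpha> x = x - (x \<bullet> coroot \<alpha>) *\<^sub>R \<alpha>"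

definition root_system :: "'a::euclidean_space set \<Rightarrow> bool" where
  "root_system \<Phi> \<longleftrightarrow>
     finite \<Phi> \<and> 0 \<notin> \<Phi> \<and> span \<Phi> = UNIV \<and>
     (\<forall>\<alpha>\<in>\<Phi>. root_reflection \<alpha> ` \<Phi> = \<Phi>) \<and>
     (\<forall>\<alpha>\<in>\<Phi>. \<forall>\<beta>\<in>\<Phi>. \<beta> \<bullet> coroot \<alpha> \<in> \<int>)"

definition reduced_roots :: "'a::euclidean_space set \<Rightarrow> bool" where
  "reduced_roots \<Phi> \<longleftrightarrow> (\<forall>\<alpha>\<in>\<Phi>. \<forall>c. c *\<^sub>R \<alpha> \<in> \<Phi> \<longrightarrow> c = 1 \<or> c = -1)"

definition irreducible_roots :: "'a::euclidean_space set \<Rightarrow> bool" where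
  "irreducible_roots \<Phi> \<longleftrightarrow>
     \<Phi> \<noteq> {} \<and>
     \<not> (\<exists>A B. A \<noteq> {} \<and> B \<noteq> {} \<and> A \<union> B = \<Phi> \<and> A \<inter> B = {} \<and>
             (\<forall>\<alpha>\<in>A. \<forall>\<beta>\<in>B. \<alpha> \<bullet> \<beta> = 0))"

definition root_lattice :: "'a::euclidean_space set \<Rightarrow> 'a set" where
  "root_lattice \<Phi> = {(\<Sum>\<alpha>\<in>\<Phi>. of_int (c \<alpha>) *\<^sub>R \<alpha>) | c :: 'a \<Rightarrow> int. True}"

definition weight_lattice :: "'a::euclidean_space set \<Rightarrow> 'a set" where
  "weight_lattice \<Phi> = {x. \<forall>\<alpha>\<in>\<Phi>. x \<bullet> coroot \<alpha> \<in> \<int>}"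

text \<open>Chambers are taken to be open.\<close>

definition weyl_chambers :: "'a::euclidean_space set \<Rightarrow> 'a set set" where
  "weyl_chambers \<Phi> = components {h. \<forall>\<alpha>\<in>\<Phi>. \<alpha> \<bullet> h \<noteq> 0}"

definition positive_roots :: "'a::euclidean_space set \<Rightarrow> 'a set \<Rightarrow> 'a set" where
  "positive_roots \<Phi> \<sigma> = {\<alpha>\<in>\<Phi>. \<forall>h\<in>\<sigma>. \<alpha> \<bullet> h > 0}"

definition simple_roots :: "'a::euclidean_space set \<Rightarrow> 'a set \<Rightarrow> 'a set" where
  "simple_roots \<Phi> \<sigma> =
     {\<alpha>\<in>positive_roots \<Phi> \<sigma>.
        \<not> (\<exists>\<beta>\<in>positive_roots \<Phi> \<sigma>. \<exists>\<gamma>\<in>positive_roots \<Phi> \<sigma>. \<alpha> = \<beta> + \<gamma>)}"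

definition chamber_dominant :: "'a::euclidean_space set \<Rightarrow> 'a set \<Rightarrow> 'a \<Rightarrow> bool" where
  "chamber_dominant \<Phi> \<sigma> x \<longleftrightarrow> (\<forall>\<alpha>\<in>simple_roots \<Phi> \<sigma>. x \<bullet> coroot \<alpha> \<ge> 0)"

text \<open>Adjacent chambers are distinct chambers whose closures share a face of codimension one.\<close>

definition adjacent_chambers ::
  "'a::euclidean_space set \<Rightarrow> 'a set \<Rightarrow> 'a set \<Rightarrow> bool" where
  "adjacent_chambers \<Phi> \<sigma> \<sigma>' \<longleftrightarrow>
     \<sigma> \<in> weyl_chambers \<Phi> \<and> \<sigma>' \<in> weyl_chambers \<Phi> \<and> \<sigma> \<noteq> \<sigma>' \<and>
     aff_dim (closure \<sigma> \<inter> closure \<sigma>') = int DIM('a) - 1"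

definition separating_root :: "'a::euclidean_space set \<Rightarrow> 'a set \<Rightarrow> 'a set \<Rightarrow> 'a" where
  "separating_root \<Phi> \<sigma> \<sigma>' =
     (THE \<alpha>. \<alpha> \<in> \<Phi> \<and> (\<forall>h\<in>\<sigma>. \<alpha> \<bullet> h > 0) \<and> (\<forall>h\<in>\<sigma>'. \<alpha> \<bullet> h < 0))"

definition ample_polytope_with ::
  "'a::euclidean_space set \<Rightarrow> ('a set \<Rightarrow> 'a) \<Rightarrow> 'a set \<Rightarrow> bool" where
  "ample_polytope_with \<Phi> \<mu> P \<longleftrightarrow>
     polytope P \<and>
     {v. v extreme_point_of P} = \<mu> ` weyl_chambers \<Phi> \<and>
     \<mu> ` weyl_chambers \<Phi> \<subseteq> weight_lattice \<Phi> \<and>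
     (\<forall>\<sigma> \<sigma>'. adjacent_chambers \<Phi> \<sigma> \<sigma>' \<longrightarrow>
        (\<exists>r::int. r > 0 \<and> \<mu> \<sigma> - \<mu> \<sigma>' = of_int r *\<^sub>R separating_root \<Phi> \<sigma> \<sigma>'))"

definition special_ample_polytope :: "'a::euclidean_space set \<Rightarrow> 'a set \<Rightarrow> bool" where
  "special_ample_polytope \<Phi> P \<longleftrightarrow>
     (\<exists>\<mu>. ample_polytope_with \<Phi> \<mu> P \<and> (\<forall>\<sigma>\<in>weyl_chambers \<Phi>. chamber_dominant \<Phi> \<sigma> (\<mu> \<sigma>)))"

text \<open>
  \<open>\<Lambda>(P) = P \<inter> (\<mu>\<^sub>\<sigma> + Y)\<close>. The points \<open>\<mu>\<^sub>\<sigma>\<close> of an ample polytope are exactly its vertices and all lie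
  in the same coset of \<open>Y\<close>, so \<open>\<mu>\<^sub>\<sigma>\<close> may be replaced by an arbitrary vertex.
\<close>

definition lattice_points :: "'a::euclidean_space set \<Rightarrow> 'a set \<Rightarrow> 'a set" where
  "lattice_points \<Phi> P = {x\<in>P. \<exists>v. v extreme_point_of P \<and> x - v \<in> root_lattice \<Phi>}"

text \<open>The tuples \<open>(x\<^sub>1, \<dots>, x\<^sub>m)\<close> are functions on \<open>{1..m}\<close>, \<open>undefined\<close> elsewhere.\<close>

definition lattice_tuples ::
  "'a::euclidean_space set \<Rightarrow> nat \<Rightarrow> (nat \<Rightarrow> 'a set) \<Rightarrow> (nat \<Rightarrow> 'a) set" where
  "lattice_tuples \<Phi> m P = (\<Pi>\<^sub>E i\<in>{1..m}. lattice_points \<Phi> (P i))"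

definition root_move ::
  "'a::euclidean_space set \<Rightarrow> nat \<Rightarrow> (nat \<Rightarrow> 'a set) \<Rightarrow> (nat \<Rightarrow> 'a) \<Rightarrow> (nat \<Rightarrow> 'a) \<Rightarrow> bool" where
  "root_move \<Phi> m P t u \<longleftrightarrow>
     t \<in> lattice_tuples \<Phi> m P \<and>
     (\<exists>\<beta>\<in>\<Phi>. \<exists>i\<in>{1..m}. \<exists>j\<in>{1..m}. i \<noteq> j \<and>
        t i + \<beta> \<in> lattice_points \<Phi> (P i) \<and> t j - \<beta> \<in> lattice_points \<Phi> (P j) \<and>
        u = t(i := t i + \<beta>, j := t j - \<beta>))"

text \<open>
  Root moves only relate elements of \<open>lattice_tuples\<close>, so on that set \<open>equivclp\<close> yields the
  equivalence relation they generate there.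
\<close>

definition root_move_equiv ::
  "'a::euclidean_space set \<Rightarrow> nat \<Rightarrow> (nat \<Rightarrow> 'a set) \<Rightarrow> (nat \<Rightarrow> 'a) \<Rightarrow> (nat \<Rightarrow> 'a) \<Rightarrow> bool" where
  "root_move_equiv \<Phi> m P = equivclp (root_move \<Phi> m P)"

end

(*
  For a chamber containing a regular vector h, a lattice point x is compared with the vertex m h of
  an ample polytope by expanding m h - x in the simple roots. For special polytopes two facts about
  the set L of lattice points hold:
  - a point x dominant for h lies in L as soon as it lies below m h for that single chamber;
  - if x is in L and (x, b) > 0 for a root b, then x - b is in L.
  By the second fact, a root b with (z, b) > 0 can be subtracted from some entry of any tuple with
  sum z, and the class of the result depends only on the class of the tuple. This yields (i) by
  induction on |x| downwards: if x is dominant for h and x is not m h, then a maximal root g <= m h - x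
  gives a dominant x + g in L, and |x + g| > |x|.
  For (ii), again by induction on |x| downwards, attach to a tuple t with dominant sum x the set R(t)
  of positive roots that can be added to an entry of some tuple equivalent to t. If t and t' are not
  equivalent, the induction hypothesis forces (b, b') <= 0 for all b in R(t), b' in R(t').
  On the other hand u = m h - x lies in the cones spanned by R(t) and by R(t'), so (u, u) <= 0 and
  u = 0, in which case the only tuple is the tuple of vertices.
*)
theory Submission
  imports Defs
begin

subsection \<open>Root systems\<close>

text \<open>Two small gains drive everything. When a simple wall is crossed, dominance of the vertex
  on the far side bounds the new coefficient t only by 2t \<ge> -1; integrality then gives t \<ge>
  0. This spare half unit is what allows a root to be subtracted and not merely a wall to be
  crossed. In (ii), a positive pairing of b in R(t) with b' in R(t') makes b - b' zero or a root.
  The tuples raised by b and by b' lie over sums of larger norm, where uniqueness is known; lowering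
  one of them in two stages, by the difference and then by the other root, links the classes of t
  and t'. Membership in a cone is always stated in dual form: a vector w that is non-positive on the
  generators is non-positive on u. So no combination of roots has to be tracked, and two
  applications, with w a root of one set and then w = u, give (u, u) \<le> 0. The combinatorics sees
  only one vertex per chamber and the edges across simple walls. A Minkowski sum is therefore
  represented by the sums of the vertices, and the geometry of polytopes is confined to the last
  part.\<close>

lemma inner_coroot: "x \<bullet> coroot \<alpha> = 2 * (x \<bullet> \<alpha>) / (\<alpha> \<bullet> \<alpha>)"
  by (simp add: coroot_def)

lemma root_reflection_self_adjoint:
  "root_reflection \<alpha> x \<bullet> y = x \<bullet> root_reflection \<alpha> y"
  by (simp add: root_reflection_def inner_coroot inner_diff inner_commute)

lemma root_reflection_involution:
  assumes "\<alpha> \<noteq> 0"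
  shows "root_reflection \<alpha> (root_reflection \<alpha> x) = x"
proof -
  have "\<alpha> \<bullet> coroot \<alpha> = 2" using assms by (simp add: inner_coroot)
  then show ?thesis
    by (simp add: root_reflection_def inner_diff_left algebra_simps)
qed

lemma Ints_pos_ge_1:
  fixes x :: real
  assumes "x \<in> \<int>" "x > 0"
  shows "x \<ge> 1"
  using assms by (auto elim!: Ints_cases)

locale root_sys =
  fixes \<Phi> :: "'a::euclidean_space set"
  assumes root_system: "root_system \<Phi>" and reduced: "reduced_roots \<Phi>"
begin

lemma finite_roots: "finite \<Phi>"
  and zero_notin_roots: "0 \<notin> \<Phi>"
  and span_roots: "span \<Phi> = UNIV"
  using root_system by (auto simp: root_system_def)

lemma root_nonzero: "\<alpha> \<in> \<Phi> \<Longrightarrow> \<alpha> \<noteq> 0"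
  using zero_notin_roots by auto

lemma inner_root_pos: "\<alpha> \<in> \<Phi> \<Longrightarrow> \<alpha> \<bullet> \<alpha> > 0"
  using root_nonzero by simp

lemma reflection_root: "\<alpha> \<in> \<Phi> \<Longrightarrow> \<beta> \<in> \<Phi> \<Longrightarrow> root_reflection \<alpha> \<beta> \<in> \<Phi>"
  using root_system by (auto simp: root_system_def)

lemma cartan_int: "\<alpha> \<in> \<Phi> \<Longrightarrow> \<beta> \<in> \<Phi> \<Longrightarrow> \<beta> \<bullet> coroot \<alpha> \<in> \<int>"
  using root_system by (auto simp: root_system_def)

lemma root_coroot_self: "\<alpha> \<in> \<Phi> \<Longrightarrow> \<alpha> \<bullet> coroot \<alpha> = 2"
  using root_nonzero by (simp add: inner_coroot)

lemma uminus_root: "\<alpha> \<in> \<Phi> \<Longrightarrow> - \<alpha> \<in> \<Phi>"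
  using reflection_root[of \<alpha> \<alpha>] root_coroot_self[of \<alpha>]
  by (simp add: root_reflection_def scaleR_2)

lemma inner_coroot_pos_iff: "\<alpha> \<in> \<Phi> \<Longrightarrow> x \<bullet> coroot \<alpha> > 0 \<longleftrightarrow> x \<bullet> \<alpha> > 0"
  using inner_root_pos[of \<alpha>] by (simp add: inner_coroot zero_less_divide_iff del: inner_gt_zero_iff)

lemma inner_coroot_nonneg_iff: "\<alpha> \<in> \<Phi> \<Longrightarrow> x \<bullet> coroot \<alpha> \<ge> 0 \<longleftrightarrow> x \<bullet> \<alpha> \<ge> 0"
  using inner_root_pos[of \<alpha>] by (simp add: inner_coroot zero_le_divide_iff del: inner_gt_zero_iff)

text \<open>If both Cartan integers were at least 2, the inner product would be at least both
  squared lengths and the difference would vanish. So one of them is 1, and a single reflection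
  gives the difference up to sign.\<close>

lemma diff_root:
  assumes a: "\<alpha> \<in> \<Phi>" and b: "\<beta> \<in> \<Phi>" and pos: "\<alpha> \<bullet> \<beta> > 0" and ne: "\<alpha> \<noteq> \<beta>"
  shows "\<alpha> - \<beta> \<in> \<Phi>"
proof -
  let ?m = "\<alpha> \<bullet> coroot \<beta>" and ?n = "\<beta> \<bullet> coroot \<alpha>"
  have m: "?m \<ge> 1" using pos b cartan_int[OF b a] inner_coroot_pos_iff[OF b] Ints_pos_ge_1 by blast
  have n: "?n \<ge> 1"
    using pos a cartan_int[OF a b] inner_coroot_pos_iff[OF a, of \<beta>] Ints_pos_ge_1
    by (metis inner_commute)
  have "?m = 1 \<or> ?n = 1"
  proof (rule ccontr)
    assume "\<not> ?thesis"
    moreover have "?m - 1 \<in> \<int>" "?n - 1 \<in> \<int>" using cartan_int a b by auto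
    ultimately have m2: "?m \<ge> 2" and n2: "?n \<ge> 2"
      using m n Ints_pos_ge_1[of "?m - 1"] Ints_pos_ge_1[of "?n - 1"] by linarith+
    have "\<alpha> \<bullet> \<beta> \<ge> \<beta> \<bullet> \<beta>" using m2 inner_root_pos[OF b]
      by (simp add: inner_coroot le_divide_eq)
    moreover have "\<alpha> \<bullet> \<beta> \<ge> \<alpha> \<bullet> \<alpha>" using n2 inner_root_pos[OF a]
      by (simp add: inner_coroot le_divide_eq inner_commute)
    ultimately have "(\<alpha> - \<beta>) \<bullet> (\<alpha> - \<beta>) \<le> 0"
      by (simp add: inner_diff inner_commute)
    moreover have "(\<alpha> - \<beta>) \<bullet> (\<alpha> - \<beta>) > 0" using ne by simp
    ultimately show False by linarith
  qed
  then show ?thesis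
  proof
    assume "?m = 1"
    with reflection_root[OF b a] show ?thesis by (simp add: root_reflection_def)
  next
    assume "?n = 1"
    with uminus_root[OF reflection_root[OF a b]] show ?thesis by (simp add: root_reflection_def)
  qed
qed

lemma sum_root:
  assumes "\<alpha> \<in> \<Phi>" "\<beta> \<in> \<Phi>" "\<alpha> \<bullet> \<beta> < 0" "\<alpha> \<noteq> - \<beta>"
  shows "\<alpha> + \<beta> \<in> \<Phi>"
  using diff_root[of \<alpha> "- \<beta>"] assms uminus_root by auto

section \<open>The root lattice\<close>

definition Y :: "'a set" where "Y = root_lattice \<Phi>"

lemma Y_zero: "0 \<in> Y"
  unfolding Y_def root_lattice_def by (rule CollectI, rule exI[of _ "\<lambda>_. 0"]) simp

lemma Y_add: assumes "x \<in> Y" "y \<in> Y" shows "x + y \<in> Y"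
proof -
  obtain c d where "x = (\<Sum>\<alpha>\<in>\<Phi>. of_int (c \<alpha>) *\<^sub>R \<alpha>)" "y = (\<Sum>\<alpha>\<in>\<Phi>. of_int (d \<alpha>) *\<^sub>R \<alpha>)"
    using assms by (auto simp: Y_def root_lattice_def)
  then have "x + y = (\<Sum>\<alpha>\<in>\<Phi>. of_int (c \<alpha> + d \<alpha>) *\<^sub>R \<alpha>)"
    by (simp add: sum.distrib scaleR_left_distrib)
  then show ?thesis unfolding Y_def root_lattice_def by (intro CollectI exI[of _ "\<lambda>\<alpha>. c \<alpha> + d \<alpha>"]) simp
qed

lemma Y_scale: assumes "x \<in> Y" shows "of_int k *\<^sub>R x \<in> Y"
proof -
  obtain c where "x = (\<Sum>\<alpha>\<in>\<Phi>. of_int (c \<alpha>) *\<^sub>R \<alpha>)"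
    using assms by (auto simp: Y_def root_lattice_def)
  then have "of_int k *\<^sub>R x = (\<Sum>\<alpha>\<in>\<Phi>. of_int (k * c \<alpha>) *\<^sub>R \<alpha>)"
    by (simp add: scaleR_sum_right)
  then show ?thesis unfolding Y_def root_lattice_def by (intro CollectI exI[of _ "\<lambda>\<alpha>. k * c \<alpha>"]) simp
qed

lemma Y_uminus: "x \<in> Y \<Longrightarrow> - x \<in> Y"
  using Y_scale[of x "-1"] by simp

lemma Y_diff: "x \<in> Y \<Longrightarrow> y \<in> Y \<Longrightarrow> x - y \<in> Y"
  using Y_add[of x "- y"] Y_uminus by simp

lemma Y_sum: "(\<And>i. i \<in> A \<Longrightarrow> f i \<in> Y) \<Longrightarrow> sum f A \<in> Y"
  by (induction A rule: infinite_finite_induct) (auto simp: Y_zero Y_add)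

lemma root_in_Y: assumes "\<alpha> \<in> \<Phi>" shows "\<alpha> \<in> Y"
proof -
  have "\<alpha> = (\<Sum>\<beta>\<in>\<Phi>. if \<beta> = \<alpha> then \<beta> else 0)" using assms finite_roots by (simp add: sum.delta')
  also have "\<dots> = (\<Sum>\<beta>\<in>\<Phi>. of_int (if \<beta> = \<alpha> then 1 else 0) *\<^sub>R \<beta>)"
    by (intro sum.cong) auto
  finally show ?thesis unfolding Y_def root_lattice_def
    by (intro CollectI exI[of _ "\<lambda>\<beta>. if \<beta> = \<alpha> then 1 else 0"]) simp
qed

lemma Y_pairing_int: assumes "x \<in> Y" "\<alpha> \<in> \<Phi>" shows "x \<bullet> coroot \<alpha> \<in> \<int>"
proof -
  obtain c where "x = (\<Sum>\<beta>\<in>\<Phi>. of_int (c \<beta>) *\<^sub>R \<beta>)"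
    using assms by (auto simp: Y_def root_lattice_def)
  then have "x \<bullet> coroot \<alpha> = (\<Sum>\<beta>\<in>\<Phi>. of_int (c \<beta>) * (\<beta> \<bullet> coroot \<alpha>))"
    by (simp add: inner_sum_left)
  then show ?thesis using cartan_int assms by (auto intro!: Ints_sum Ints_mult)
qed

section \<open>Positive and simple roots of a regular vector\<close>

definition regular :: "'a \<Rightarrow> bool" where "regular h \<longleftrightarrow> (\<forall>\<alpha>\<in>\<Phi>. \<alpha> \<bullet> h \<noteq> 0)"

text \<open>Chambers are handled through regular representatives; two representatives belong to the
  same chamber exactly when their sets \<open>pos\<close> agree.\<close>

definition pos :: "'a \<Rightarrow> 'a set" where "pos h = {\<alpha>\<in>\<Phi>. \<alpha> \<bullet> h > 0}"

definition simple :: "'a \<Rightarrow> 'a set" where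
  "simple h = {\<alpha>\<in>pos h. \<not> (\<exists>\<beta>\<in>pos h. \<exists>\<gamma>\<in>pos h. \<alpha> = \<beta> + \<gamma>)}"

lemma pos_root: "\<alpha> \<in> pos h \<Longrightarrow> \<alpha> \<in> \<Phi>"
  and pos_inner: "\<alpha> \<in> pos h \<Longrightarrow> \<alpha> \<bullet> h > 0"
  and simple_pos: "\<alpha> \<in> simple h \<Longrightarrow> \<alpha> \<in> pos h"
  by (auto simp: pos_def simple_def)

lemma simple_root: "\<alpha> \<in> simple h \<Longrightarrow> \<alpha> \<in> \<Phi>"
  using pos_root simple_pos by blast

lemma finite_pos: "finite (pos h)" and finite_simple: "finite (simple h)"
  using finite_roots by (auto simp: pos_def simple_def)

lemma uminus_pos: "\<alpha> \<in> pos h \<Longrightarrow> - \<alpha> \<notin> pos h"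
  by (auto simp: pos_def)

lemma pos_or_neg: "regular h \<Longrightarrow> \<alpha> \<in> \<Phi> \<Longrightarrow> \<alpha> \<in> pos h \<or> - \<alpha> \<in> pos h"
  using uminus_root by (force simp: pos_def regular_def)

lemma pos_add: "\<alpha> \<in> pos h \<Longrightarrow> \<beta> \<in> pos h \<Longrightarrow> \<alpha> + \<beta> \<in> \<Phi> \<Longrightarrow> \<alpha> + \<beta> \<in> pos h"
  by (auto simp: pos_def inner_add)

text \<open>The pairing with \<open>h\<close> drops strictly from a decomposable root to its
  summands, and there are only finitely many positive roots.\<close>

lemma pos_induct [consumes 1, case_names simple add]:
  assumes "\<gamma> \<in> pos h"
    and base: "\<And>\<alpha>. \<alpha> \<in> simple h \<Longrightarrow> Q \<alpha>"
    and step: "\<And>\<alpha> \<beta>. \<alpha> \<in> pos h \<Longrightarrow> \<beta> \<in> pos h \<Longrightarrow> Q \<alpha> \<Longrightarrow> Q \<beta> \<Longrightarrow> Q (\<alpha> + \<beta>)"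
  shows "Q \<gamma>"
  using assms(1)
proof (induction "card {\<beta>\<in>pos h. \<beta> \<bullet> h < \<gamma> \<bullet> h}" arbitrary: \<gamma> rule: less_induct)
  case less
  show ?case
  proof (cases "\<gamma> \<in> simple h")
    case False
    then obtain \<alpha> \<beta> where ab: "\<alpha> \<in> pos h" "\<beta> \<in> pos h" "\<gamma> = \<alpha> + \<beta>"
      using less.prems by (auto simp: simple_def)
    have *: "card {\<delta>\<in>pos h. \<delta> \<bullet> h < \<epsilon> \<bullet> h} < card {\<delta>\<in>pos h. \<delta> \<bullet> h < \<gamma> \<bullet> h}"
      if "\<epsilon> \<in> pos h" "\<epsilon> \<bullet> h < \<gamma> \<bullet> h" for \<epsilon>
      using that finite_pos by (intro psubset_card_mono) auto
    have "\<alpha> \<bullet> h < \<gamma> \<bullet> h" "\<beta> \<bullet> h < \<gamma> \<bullet> h"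
      using ab pos_inner[of \<alpha> h] pos_inner[of \<beta> h] by (auto simp: inner_add)
    then have "Q \<alpha>" "Q \<beta>"
      using ab less.hyps * by blast+
    with ab step show ?thesis by blast
  qed (rule base)
qed

text \<open>At an acute angle the difference would be a root, and whichever sign of it is positive
  would decompose one of the two simple roots.\<close>

lemma simple_obtuse:
  assumes reg: "regular h" and a: "\<alpha> \<in> simple h" and b: "\<beta> \<in> simple h" and ne: "\<alpha> \<noteq> \<beta>"
  shows "\<alpha> \<bullet> \<beta> \<le> 0"
proof (rule ccontr)
  assume "\<not> ?thesis"
  then have "\<alpha> - \<beta> \<in> \<Phi>" using diff_root a b ne simple_root by force
  from pos_or_neg[OF reg this] show False
  proof
    assume "\<alpha> - \<beta> \<in> pos h"
    moreover have "\<alpha> = \<beta> + (\<alpha> - \<beta>)" by simp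
    ultimately show False using a b unfolding simple_def by blast
  next
    assume "- (\<alpha> - \<beta>) \<in> pos h"
    moreover have "\<beta> = \<alpha> + - (\<alpha> - \<beta>)" by simp
    ultimately show False using a b unfolding simple_def by blast
  qed
qed

text \<open>Let v be the part of a relation with positive coefficients. Obtuse angles give v
  \<bullet> v \<le> 0, so v = 0, while a nonempty positive combination of positive roots pairs
  positively with \<open>h\<close>. This bounds the coefficients by 0 from above only, hence the use
  for both \<open>c\<close> and its negative.\<close>

lemma independent_simple:
  assumes reg: "regular h"
  shows "independent (simple h)"
proof -
  have zero: "c \<beta> \<le> 0"
    if sum0: "(\<Sum>\<alpha>\<in>simple h. c \<alpha> *\<^sub>R \<alpha>) = 0" and b: "\<beta> \<in> simple h" for c :: "'a \<Rightarrow> real" and \<beta>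
  proof -
    define A where "A = {\<alpha>\<in>simple h. c \<alpha> > 0}"
    define B where "B = {\<alpha>\<in>simple h. \<not> c \<alpha> > 0}"
    have fin: "finite A" "finite B" using finite_simple by (auto simp: A_def B_def)
    have AB: "simple h = A \<union> B" "A \<inter> B = {}" by (auto simp: A_def B_def)
    define v where "v = (\<Sum>\<alpha>\<in>A. c \<alpha> *\<^sub>R \<alpha>)"
    have v2: "v = - (\<Sum>\<beta>\<in>B. c \<beta> *\<^sub>R \<beta>)"
      using sum0 fin AB by (simp add: v_def sum.union_disjoint eq_neg_iff_add_eq_0)
    have "v \<bullet> v = - (\<Sum>\<alpha>\<in>A. \<Sum>\<beta>\<in>B. c \<alpha> * c \<beta> * (\<alpha> \<bullet> \<beta>))"
      by (subst (2) v2, simp only: v_def)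
        (simp add: inner_sum_left inner_sum_right sum_distrib_left mult.assoc
          sum.swap[of _ A B] mult.left_commute)
    also have "\<dots> \<le> 0"
    proof -
      have "0 \<le> c \<alpha> * c \<beta> * (\<alpha> \<bullet> \<beta>)" if "\<alpha> \<in> A" "\<beta> \<in> B" for \<alpha> \<beta>
      proof -
        have "c \<alpha> * c \<beta> \<le> 0" using that by (auto simp: A_def B_def mult_le_0_iff)
        moreover have "\<alpha> \<bullet> \<beta> \<le> 0" using that simple_obtuse[OF reg] by (auto simp: A_def B_def)
        ultimately show ?thesis by (rule mult_nonpos_nonpos)
      qed
      then show ?thesis by (simp add: sum_nonneg)
    qed
    finally have "v = 0" by (metis inner_gt_zero_iff not_less)
    then have "(\<Sum>\<alpha>\<in>A. c \<alpha> * (\<alpha> \<bullet> h)) = 0"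
      by (metis (no_types, lifting) v_def inner_sum_left inner_scaleR_left inner_zero_left sum.cong)
    moreover have "c \<alpha> * (\<alpha> \<bullet> h) > 0" if "\<alpha> \<in> A" for \<alpha>
      using that pos_inner simple_pos by (auto simp: A_def)
    ultimately have "A = {}" using fin sum_pos[of A "\<lambda>\<alpha>. c \<alpha> * (\<alpha> \<bullet> h)"] by fastforce
    with b show ?thesis by (auto simp: A_def)
  qed
  show ?thesis
  proof (rule independent_if_scalars_zero)
    fix c \<beta> assume s: "(\<Sum>\<alpha>\<in>simple h. c \<alpha> *\<^sub>R \<alpha>) = 0" and b: "\<beta> \<in> simple h"
    have "(\<Sum>\<alpha>\<in>simple h. (- c \<alpha>) *\<^sub>R \<alpha>) = 0" using s by (simp add: sum_negf)
    from zero[OF this b] zero[OF s b] show "c \<beta> = 0" by simp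
  qed (rule finite_simple)
qed

lemma span_simple:
  assumes reg: "regular h"
  shows "span (simple h) = UNIV"
proof -
  have p: "\<gamma> \<in> span (simple h)" if "\<gamma> \<in> pos h" for \<gamma>
    using that by (induction rule: pos_induct) (auto intro: span_base span_add)
  have "\<Phi> \<subseteq> span (simple h)"
  proof
    fix \<alpha> assume "\<alpha> \<in> \<Phi>"
    with pos_or_neg[OF reg] p[of \<alpha>] p[of "- \<alpha>"] span_neg[of "- \<alpha>"] show "\<alpha> \<in> span (simple h)" by auto
  qed
  with span_roots show ?thesis by (metis span_minimal subspace_span top.extremum_uniqueI)
qed

section \<open>Coordinates with respect to the simple roots\<close>

definition coef :: "'a \<Rightarrow> 'a \<Rightarrow> 'a \<Rightarrow> real" where
  "coef h v \<alpha> = representation (simple h) v \<alpha>"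

context
  fixes h assumes reg: "regular h"
begin

lemma coef_add: "coef h (v + w) \<alpha> = coef h v \<alpha> + coef h w \<alpha>"
  by (simp add: coef_def representation_add independent_simple reg span_simple)

lemma coef_diff: "coef h (v - w) \<alpha> = coef h v \<alpha> - coef h w \<alpha>"
  by (simp add: coef_def representation_diff independent_simple reg span_simple)

lemma coef_scale: "coef h (r *\<^sub>R v) \<alpha> = r * coef h v \<alpha>"
  by (simp add: coef_def representation_scale independent_simple reg span_simple)

lemma coef_uminus: "coef h (- v) \<alpha> = - coef h v \<alpha>"
  using coef_scale[of "-1"] by simp

lemma coef_zero: "coef h 0 \<alpha> = 0"
  by (simp add: coef_def representation_zero)

lemma coef_sum: "coef h (\<Sum>i\<in>A. f i) \<alpha> = (\<Sum>i\<in>A. coef h (f i) \<alpha>)"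
  by (induction A rule: infinite_finite_induct) (auto simp: coef_add coef_zero)

lemma coef_simple: "\<beta> \<in> simple h \<Longrightarrow> coef h \<beta> \<alpha> = (if \<alpha> = \<beta> then 1 else 0)"
  by (simp add: coef_def representation_basis independent_simple reg)

lemma coef_expand: "v = (\<Sum>\<alpha>\<in>simple h. coef h v \<alpha> *\<^sub>R \<alpha>)"
  using sum_representation_eq[OF independent_simple[OF reg] _ finite_simple subset_refl, of v]
  by (simp add: coef_def span_simple reg)

lemma coef_pos: "\<beta> \<in> pos h \<Longrightarrow> coef h \<beta> \<alpha> \<in> \<int> \<and> coef h \<beta> \<alpha> \<ge> 0"
  by (induction rule: pos_induct) (auto simp: coef_simple coef_add)

lemma coef_root_int: "\<beta> \<in> \<Phi> \<Longrightarrow> coef h \<beta> \<alpha> \<in> \<int>"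
  using pos_or_neg[OF reg, of \<beta>] coef_pos[of \<beta> \<alpha>] coef_pos[of "- \<beta>" \<alpha>] coef_uminus[of \<beta> \<alpha>]
  by (metis Ints_minus minus_minus)

lemma coef_int:
  assumes "v \<in> Y" shows "coef h v \<alpha> \<in> \<int>"
proof -
  obtain c where "v = (\<Sum>\<beta>\<in>\<Phi>. of_int (c \<beta>) *\<^sub>R \<beta>)"
    using assms by (auto simp: Y_def root_lattice_def)
  then have "coef h v \<alpha> = (\<Sum>\<beta>\<in>\<Phi>. of_int (c \<beta>) * coef h \<beta> \<alpha>)"
    by (simp add: coef_sum coef_scale)
  then show ?thesis using coef_root_int by (auto intro!: Ints_sum Ints_mult)
qed

lemma pos_if_coef_pos:
  assumes "\<beta> \<in> \<Phi>" "coef h \<beta> \<alpha> > 0" shows "\<beta> \<in> pos h"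
  using pos_or_neg[OF reg assms(1)] coef_pos[of "- \<beta>" \<alpha>] assms(2) by (auto simp: coef_uminus)

text \<open>Reducedness excludes multiples of \<alpha>, so \<beta> has a positive coordinate at some
  other simple root. The reflection changes only the coordinate at \<alpha>, and one positive
  coordinate decides the sign of a root.\<close>

lemma simple_reflection_pos:
  assumes a: "\<alpha> \<in> simple h" and b: "\<beta> \<in> pos h" and ne: "\<beta> \<noteq> \<alpha>"
  shows "root_reflection \<alpha> \<beta> \<in> pos h"
proof -
  have "\<exists>\<gamma>\<in>simple h. \<gamma> \<noteq> \<alpha> \<and> coef h \<beta> \<gamma> > 0"
  proof (rule ccontr)
    assume "\<not> ?thesis"
    then have "coef h \<beta> \<gamma> = 0" if "\<gamma> \<in> simple h" "\<gamma> \<noteq> \<alpha>" for \<gamma>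
      using that coef_pos[OF b, of \<gamma>] by force
    then have "\<beta> = (\<Sum>\<gamma>\<in>simple h. if \<gamma> = \<alpha> then coef h \<beta> \<alpha> *\<^sub>R \<alpha> else 0)"
      by (subst coef_expand) (auto intro!: sum.cong)
    then have e: "\<beta> = coef h \<beta> \<alpha> *\<^sub>R \<alpha>" using a finite_simple by (simp add: sum.delta)
    with b have "coef h \<beta> \<alpha> *\<^sub>R \<alpha> \<in> \<Phi>" using pos_root by metis
    then have "coef h \<beta> \<alpha> = 1 \<or> coef h \<beta> \<alpha> = -1"
      using reduced simple_root[OF a] by (auto simp: reduced_roots_def)
    with coef_pos[OF b, of \<alpha>] e ne show False by auto
  qed
  then obtain \<gamma> where g: "\<gamma> \<in> simple h" "\<gamma> \<noteq> \<alpha>" "coef h \<beta> \<gamma> > 0" by blast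
  have "coef h (root_reflection \<alpha> \<beta>) \<gamma> = coef h \<beta> \<gamma>"
    using g a by (simp add: root_reflection_def coef_diff coef_scale coef_simple)
  then show ?thesis
    using pos_if_coef_pos reflection_root simple_root[OF a] pos_root[OF b] g by metis
qed

end

section \<open>Crossing a simple wall\<close>

lemma regular_reflection:
  assumes "\<alpha> \<in> \<Phi>" "regular h" shows "regular (root_reflection \<alpha> h)"
  using assms reflection_root
  by (auto simp: regular_def root_reflection_self_adjoint[symmetric])

lemma pos_reflection:
  assumes "\<alpha> \<in> \<Phi>"
  shows "\<beta> \<in> pos (root_reflection \<alpha> h) \<longleftrightarrow> root_reflection \<alpha> \<beta> \<in> pos h"
  using assms reflection_root[of \<alpha> \<beta>] reflection_root[of \<alpha> "root_reflection \<alpha> \<beta>"]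
    root_reflection_involution[of \<alpha> \<beta>] root_nonzero
  by (auto simp: pos_def root_reflection_self_adjoint)

lemma root_reflection_self: "\<alpha> \<in> \<Phi> \<Longrightarrow> root_reflection \<alpha> \<alpha> = - \<alpha>"
  by (simp add: root_reflection_def root_coroot_self scaleR_2)

lemma root_reflection_uminus: "root_reflection \<alpha> (- x) = - root_reflection \<alpha> x"
  by (simp add: root_reflection_def)

lemma pos_simple_reflection:
  assumes reg: "regular h" and a: "\<alpha> \<in> simple h"
  shows "pos (root_reflection \<alpha> h) = insert (- \<alpha>) (pos h - {\<alpha>})"
proof (rule set_eqI)
  fix \<beta>
  note aR = simple_root[OF a]
  note inv = root_reflection_involution[OF root_nonzero[OF aR]]
  have self: "root_reflection \<alpha> \<alpha> = - \<alpha>" by (rule root_reflection_self[OF aR])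
  show "\<beta> \<in> pos (root_reflection \<alpha> h) \<longleftrightarrow> \<beta> \<in> insert (- \<alpha>) (pos h - {\<alpha>})"
  proof
    assume "\<beta> \<in> pos (root_reflection \<alpha> h)"
    then have p: "root_reflection \<alpha> \<beta> \<in> pos h" using pos_reflection[OF aR] by blast
    show "\<beta> \<in> insert (- \<alpha>) (pos h - {\<alpha>})"
    proof (cases "root_reflection \<alpha> \<beta> = \<alpha>")
      case True
      then have "\<beta> = - \<alpha>" using inv[of \<beta>] self by simp
      then show ?thesis by simp
    next
      case False
      have "\<beta> \<in> pos h" using simple_reflection_pos[OF reg a p False] inv by simp
      moreover have "\<beta> \<noteq> \<alpha>" using p self simple_pos[OF a] uminus_pos by metis
      ultimately show ?thesis by simp
    qed
  next
    assume "\<beta> \<in> insert (- \<alpha>) (pos h - {\<alpha>})"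
    then consider "\<beta> = - \<alpha>" | "\<beta> \<in> pos h" "\<beta> \<noteq> \<alpha>" by auto
    then have "root_reflection \<alpha> \<beta> \<in> pos h"
    proof cases
      case 1
      then show ?thesis using self simple_pos[OF a] by (simp add: root_reflection_uminus)
    qed (rule simple_reflection_pos[OF reg a])
    then show "\<beta> \<in> pos (root_reflection \<alpha> h)" using pos_reflection[OF aR] by blast
  qed
qed

subsection \<open>Lattice points below the vertices of a special family\<close>

text \<open>The non-negative integral combinations of \<open>simple h\<close>: membership in
  \<open>Y\<close> already makes the coordinates integers, so only their signs are
  prescribed.\<close>

definition Qp :: "'a \<Rightarrow> 'a set" where
  "Qp h = {v\<in>Y. \<forall>\<alpha>\<in>simple h. 0 \<le> coef h v \<alpha>}"

lemma Qp_in_Y: "v \<in> Qp h \<Longrightarrow> v \<in> Y"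
  by (simp add: Qp_def)

lemma Qp_cong: "pos h = pos h' \<Longrightarrow> Qp h = Qp h'"
  by (simp add: Qp_def coef_def simple_def)

context
  fixes h assumes reg: "regular h"
begin

lemma Qp_zero: "0 \<in> Qp h"
  by (simp add: Qp_def Y_zero coef_zero reg)

lemma Qp_add: "v \<in> Qp h \<Longrightarrow> w \<in> Qp h \<Longrightarrow> v + w \<in> Qp h"
  by (simp add: Qp_def Y_add coef_add reg)

lemma Qp_sum: "(\<And>i. i \<in> A \<Longrightarrow> f i \<in> Qp h) \<Longrightarrow> sum f A \<in> Qp h"
  by (induction A rule: infinite_finite_induct) (auto simp: Qp_zero Qp_add)

lemma Qp_scale: "c \<in> \<int> \<Longrightarrow> 0 \<le> c \<Longrightarrow> v \<in> Qp h \<Longrightarrow> c *\<^sub>R v \<in> Qp h"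
  by (auto simp: Qp_def coef_scale reg Y_scale elim!: Ints_cases)

lemma Qp_pos: "\<beta> \<in> pos h \<Longrightarrow> \<beta> \<in> Qp h"
  using coef_pos[OF reg] by (simp add: Qp_def root_in_Y pos_root)

lemma Qp_inner_nonneg:
  assumes "v \<in> Qp h" and "\<And>\<alpha>. \<alpha> \<in> pos h \<Longrightarrow> 0 \<le> y \<bullet> \<alpha>"
  shows "0 \<le> y \<bullet> v"
proof -
  have "y \<bullet> v = (\<Sum>\<alpha>\<in>simple h. coef h v \<alpha> * (y \<bullet> \<alpha>))"
    by (subst coef_expand[OF reg, of v]) (simp add: inner_sum_right)
  also have "\<dots> \<ge> 0"
    using assms simple_pos by (intro sum_nonneg) (auto simp: Qp_def)
  finally show ?thesis .
qed

lemma Qp_antisym: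
  assumes "v \<in> Qp h" "- v \<in> Qp h" shows "v = 0"
proof -
  have "coef h v \<alpha> = 0" if "\<alpha> \<in> simple h" for \<alpha>
    using assms that coef_uminus[OF reg, of v \<alpha>] by (force simp: Qp_def)
  with coef_expand[OF reg, of v] show ?thesis by simp
qed

lemma Qp_coef_ge_1:
  assumes v: "v \<in> Qp h" and a: "\<alpha> \<in> simple h" and nz: "coef h v \<alpha> \<noteq> 0"
  shows "v - \<alpha> \<in> Qp h"
proof -
  have "coef h v \<alpha> \<ge> 1"
    using v a nz coef_int[OF reg Qp_in_Y[OF v], of \<alpha>]
    by (intro Ints_pos_ge_1) (auto simp: Qp_def less_le)
  then show ?thesis
    using v a by (auto simp: Qp_def coef_diff reg coef_simple Y_diff root_in_Y simple_root)
qed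

text \<open>The negative of one summand is the sum of the others, and the cone is pointed. This
  later turns equality of sums into equality of entries.\<close>

lemma Qp_zero_sum:
  assumes fin: "finite A" and s: "sum f A = 0" and f: "\<And>i. i \<in> A \<Longrightarrow> f i \<in> Qp h" and i: "i \<in> A"
  shows "f i = 0"
proof (rule Qp_antisym)
  have "- f i = sum f (A - {i})"
    using s sum.remove[OF fin i, of f] minus_unique[of "f i" "sum f (A - {i})"] by simp
  then show "- f i \<in> Qp h" using f by (auto intro: Qp_sum)
qed (rule f[OF i])

end

section \<open>Families of vertices and the points below them\<close>

text \<open>What remains of the vertices of a special ample polytope: integrality, dominance, edges
  across simple walls, and dependence on the chamber alone. Each condition survives addition of
  families.\<close>

definition special_family :: "('a \<Rightarrow> 'a) \<Rightarrow> bool" where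
  "special_family m \<longleftrightarrow> (\<forall>h. regular h \<longrightarrow>
     (\<forall>\<beta>\<in>\<Phi>. m h \<bullet> coroot \<beta> \<in> \<int>) \<and>
     (\<forall>\<beta>\<in>pos h. 0 \<le> m h \<bullet> \<beta>) \<and>
     (\<forall>\<alpha>\<in>simple h. \<exists>r::int. 0 \<le> r \<and> m h - m (root_reflection \<alpha> h) = of_int r *\<^sub>R \<alpha>) \<and>
     (\<forall>h'. regular h' \<longrightarrow> pos h' = pos h \<longrightarrow> m h' = m h))"

definition lat :: "('a \<Rightarrow> 'a) \<Rightarrow> 'a set" where
  "lat m = {x. \<forall>h. regular h \<longrightarrow> m h - x \<in> Qp h}"

lemma latD: "x \<in> lat m \<Longrightarrow> regular h \<Longrightarrow> m h - x \<in> Qp h"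
  by (simp add: lat_def)

lemma pos_subset_imp_eq:
  assumes "regular g" "regular h" "pos g \<subseteq> pos h" shows "pos g = pos h"
proof
  show "pos h \<subseteq> pos g"
    using assms pos_or_neg[of g] uminus_pos[of _ h] pos_root[of _ h] by blast
qed (rule assms)

lemma exists_simple_crossing:
  assumes "regular g" "regular h" "\<not> pos g \<subseteq> pos h"
  obtains \<alpha> where "\<alpha> \<in> simple g" "\<alpha> \<notin> pos h"
proof -
  have "\<not> simple g \<subseteq> pos h"
  proof
    assume s: "simple g \<subseteq> pos h"
    have "\<gamma> \<bullet> h > 0" if "\<gamma> \<in> pos g" for \<gamma>
      using that s by (induction rule: pos_induct) (auto simp: inner_add dest: pos_inner)
    with assms(3) show False by (auto simp: pos_def)
  qed
  with that show ?thesis by blast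
qed

text \<open>Gallery induction: chambers are crossed one simple wall at a time, and only walls that
  separate the current chamber from the target are crossed.\<close>

lemma gallery_induct:
  assumes reg: "regular g" "regular h" and Q: "Q g"
    and step: "\<And>f \<alpha>. regular f \<Longrightarrow> pos f - pos h \<subseteq> pos g \<Longrightarrow> Q f \<Longrightarrow> \<alpha> \<in> simple f \<Longrightarrow>
      \<alpha> \<in> pos g \<Longrightarrow> \<alpha> \<notin> pos h \<Longrightarrow> Q (root_reflection \<alpha> f)"
  shows "\<exists>f. regular f \<and> pos f = pos h \<and> Q f"
proof -
  have "\<exists>f. regular f \<and> pos f = pos h \<and> Q f"
    if "regular f" "pos f - pos h \<subseteq> pos g" "Q f" for f
    using that
  proof (induction "card (pos f - pos h)" arbitrary: f rule: less_induct)
    case less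
    show ?case
    proof (cases "pos f \<subseteq> pos h")
      case True
      with less.prems reg pos_subset_imp_eq show ?thesis by blast
    next
      case False
      then obtain \<alpha> where a: "\<alpha> \<in> simple f" "\<alpha> \<notin> pos h"
        using exists_simple_crossing less.prems(1) reg by blast
      have na: "- \<alpha> \<in> pos h" using a pos_or_neg[OF reg(2) simple_root[OF a(1)]] by blast
      let ?f = "root_reflection \<alpha> f"
      have p: "pos ?f - pos h = (pos f - pos h) - {\<alpha>}"
        using pos_simple_reflection[OF less.prems(1) a(1)] na by auto
      have ain: "\<alpha> \<in> pos f - pos h" using a simple_pos by blast
      have "card (pos ?f - pos h) < card (pos f - pos h)"
        unfolding p using ain finite_pos by (intro card_Diff1_less) auto
      then show ?thesis
      proof (rule less.hyps)
        show "regular ?f" using regular_reflection simple_root a(1) less.prems(1) by blast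
        show "pos ?f - pos h \<subseteq> pos g" using p less.prems(2) by auto
        show "Q ?f" using step less.prems a ain by blast
      qed
    qed
  qed
  with reg Q show ?thesis by blast
qed

context
  fixes m assumes sf: "special_family m"
begin

lemma family_int: "regular h \<Longrightarrow> \<beta> \<in> \<Phi> \<Longrightarrow> m h \<bullet> coroot \<beta> \<in> \<int>"
  and family_dominant: "regular h \<Longrightarrow> \<beta> \<in> pos h \<Longrightarrow> 0 \<le> m h \<bullet> \<beta>"
  and family_cong: "regular h \<Longrightarrow> regular h' \<Longrightarrow> pos h' = pos h \<Longrightarrow> m h' = m h"
  using sf unfolding special_family_def by blast+

lemma family_edge:
  assumes "regular h" "\<alpha> \<in> simple h"
  obtains r :: int where "0 \<le> r" "m h - m (root_reflection \<alpha> h) = of_int r *\<^sub>R \<alpha>"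
  using sf assms unfolding special_family_def by blast

text \<open>Passing to the reflected chamber keeps the coordinates at the other simple roots, which
  are reflected along, so only the coordinate at \<open>- \<alpha>\<close> has to be controlled. The
  case k = 0 transports a bound from chamber to chamber; k = 1 subtracts a root.\<close>

lemma step:
  fixes k :: int
  assumes reg: "regular h" and a: "\<alpha> \<in> simple h" and x: "m h - x \<in> Qp h"
    and k: "0 \<le> k" "k \<le> 1" "of_int k \<le> x \<bullet> coroot \<alpha>"
  shows "m (root_reflection \<alpha> h) - (x - of_int k *\<^sub>R \<alpha>) \<in> Qp (root_reflection \<alpha> h)"
proof -
  let ?g = "root_reflection \<alpha> h"
  note aR = simple_root[OF a]
  have regg: "regular ?g" by (rule regular_reflection[OF aR reg])
  obtain r :: int where r: "m h - m ?g = of_int r *\<^sub>R \<alpha>" by (rule family_edge[OF reg a])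
  define v where "v = m h - x"
  have v: "v \<in> Qp h" using x by (simp add: v_def)
  define S where "S = simple h - {\<alpha>}"
  have finS: "finite S" using finite_simple by (simp add: S_def)
  define c where "c = coef h v"
  have cint: "c \<beta> \<in> \<int>" for \<beta> using coef_int[OF reg Qp_in_Y[OF v]] by (simp add: c_def)
  have cpos: "c \<beta> \<ge> 0" if "\<beta> \<in> S" for \<beta> using v that by (auto simp: Qp_def c_def S_def)
  define N where "N = (\<Sum>\<beta>\<in>S. c \<beta> * (\<beta> \<bullet> coroot \<alpha>))"
  have Nint: "N \<in> \<int>" unfolding N_def using cint aR S_def simple_root cartan_int
    by (intro Ints_sum Ints_mult) auto
  have Nneg: "N \<le> 0" unfolding N_def
  proof (rule sum_nonpos)
    fix \<beta> assume b: "\<beta> \<in> S"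
    then have "\<beta> \<bullet> \<alpha> \<le> 0" using simple_obtuse[OF reg _ a] by (auto simp: S_def)
    then have "\<beta> \<bullet> coroot \<alpha> \<le> 0" using inner_coroot_pos_iff[OF aR, of \<beta>] by linarith
    with cpos[OF b] show "c \<beta> * (\<beta> \<bullet> coroot \<alpha>) \<le> 0" by (simp add: mult_nonneg_nonpos)
  qed
  have vexp: "v = c \<alpha> *\<^sub>R \<alpha> + (\<Sum>\<beta>\<in>S. c \<beta> *\<^sub>R \<beta>)"
    using coef_expand[OF reg, of v] sum.remove[OF finite_simple a, of "\<lambda>\<beta>. c \<beta> *\<^sub>R \<beta>"]
    by (simp add: c_def S_def)
  have prv: "v \<bullet> coroot \<alpha> = 2 * c \<alpha> + N"
    by (subst vexp) (simp add: inner_add inner_sum_left N_def root_coroot_self aR)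
  \<comment> \<open>\<open>t\<close> is the coefficient of \<open>- \<alpha>\<close> when the target
    vector is written in \<open>- \<alpha>\<close> and the reflected simple roots. In terms of
    \<open>t\<close>, the bound on \<open>x \<bullet> coroot \<alpha>\<close> below reads k \<le> 2t
    + N + 2k, where N \<le> 0.\<close>
  define t where "t = of_int r - c \<alpha> - N - of_int k"
  have "- \<alpha> \<in> pos ?g" using pos_simple_reflection[OF reg a] by simp
  then have "m ?g \<bullet> \<alpha> \<le> 0" using family_dominant[OF regg, of "- \<alpha>"] by simp
  then have mg: "m ?g \<bullet> coroot \<alpha> \<le> 0" using inner_coroot_pos_iff[OF aR, of "m ?g"] by linarith
  have xe: "x = m ?g + of_int r *\<^sub>R \<alpha> - v" using r by (simp add: v_def algebra_simps)
  have "x \<bullet> coroot \<alpha> = m ?g \<bullet> coroot \<alpha> + 2 * of_int r - (2 * c \<alpha> + N)"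
    by (subst xe) (simp add: inner_add inner_diff prv root_coroot_self aR)
  then have "2 * t \<ge> - of_int k" using mg k(3) Nneg by (simp add: t_def)
  then have t1: "2 * t \<ge> - 1" using k(2) by linarith
  have tint: "t \<in> \<int>" using Nint cint by (simp add: t_def)
  \<comment> \<open>The hypothesis k \<le> 1 keeps 2t above -2, so integrality of \<open>t\<close>
    excludes negative values.\<close>
  have t0: "t \<ge> 0"
  proof (rule ccontr)
    assume "\<not> t \<ge> 0"
    then have "- t \<ge> 1" using Ints_pos_ge_1[of "- t"] tint by auto
    with t1 show False by simp
  qed
  let ?X = "\<Sum>\<beta>\<in>S. c \<beta> *\<^sub>R root_reflection \<alpha> \<beta>"
  have "?X = (\<Sum>\<beta>\<in>S. c \<beta> *\<^sub>R \<beta>) - N *\<^sub>R \<alpha>"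
    by (simp add: root_reflection_def N_def scaleR_diff_right sum_subtractf scaleR_sum_left)
  then have v': "v = c \<alpha> *\<^sub>R \<alpha> + (?X + N *\<^sub>R \<alpha>)" using vexp by simp
  have "m ?g - (x - of_int k *\<^sub>R \<alpha>) = v - of_int r *\<^sub>R \<alpha> + of_int k *\<^sub>R \<alpha>"
    using xe by (simp add: algebra_simps)
  also have "\<dots> = ?X + t *\<^sub>R (- \<alpha>)"
    unfolding v' by (simp add: t_def algebra_simps)
  also have "\<dots> \<in> Qp ?g"
  proof (intro Qp_add[OF regg] Qp_sum[OF regg] Qp_scale[OF regg] Qp_pos[OF regg] tint t0 cint)
    show "- \<alpha> \<in> pos ?g" by fact
    fix \<beta> assume b: "\<beta> \<in> S"
    then show "c \<beta> \<ge> 0" by (rule cpos)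
    have "\<beta> \<in> pos h" using b simple_pos by (auto simp: S_def)
    then show "root_reflection \<alpha> \<beta> \<in> pos ?g"
      using pos_reflection[OF aR] root_reflection_involution[OF root_nonzero[OF aR]] by simp
  qed
  finally show ?thesis .
qed

text \<open>Every wall crossed on a gallery leaving \<open>h\<close> belongs to a root positive on
  \<open>h\<close>, with which \<open>x\<close> pairs non-negatively. So \<open>step\<close> with k
  = 0 applies at each crossing.\<close>

lemma dominant_in_lat:
  assumes reg: "regular h" and dom: "\<And>\<beta>. \<beta> \<in> pos h \<Longrightarrow> 0 \<le> x \<bullet> \<beta>" and x: "m h - x \<in> Qp h"
  shows "x \<in> lat m"
  unfolding lat_def
proof (intro CollectI allI impI)
  fix g assume g: "regular g"
  have "\<exists>f. regular f \<and> pos f = pos g \<and> m f - x \<in> Qp f"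
  proof (rule gallery_induct[where Q = "\<lambda>f. m f - x \<in> Qp f", OF reg g x])
    fix f \<alpha> assume f: "regular f" "m f - x \<in> Qp f" "\<alpha> \<in> simple f" "\<alpha> \<in> pos h"
    then have "0 \<le> x \<bullet> coroot \<alpha>" using inner_coroot_nonneg_iff simple_root dom by blast
    with step[of f \<alpha> x 0] f show "m (root_reflection \<alpha> f) - x \<in> Qp (root_reflection \<alpha> f)" by simp
  qed
  then show "m g - x \<in> Qp g" using family_cong Qp_cong g by metis
qed

text \<open>On a gallery from \<open>g\<close> to \<open>h\<close> the crossed roots \<alpha> are
  negative on \<open>h\<close>, and each crossing adds a non-negative multiple of
  \<open>- \<alpha>\<close> to the vertex.\<close>

lemma vertex_order:
  assumes reg: "regular g" "regular h"
  shows "m h - m g \<in> Qp h"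
proof -
  have "\<exists>f. regular f \<and> pos f = pos h \<and> m f - m g \<in> Qp h"
  proof (rule gallery_induct[OF reg])
    show "m g - m g \<in> Qp h" using Qp_zero reg by simp
  next
    fix f \<alpha> assume f: "regular f" "m f - m g \<in> Qp h" "\<alpha> \<in> simple f" "\<alpha> \<notin> pos h"
    obtain r :: int where r: "0 \<le> r" "m f - m (root_reflection \<alpha> f) = of_int r *\<^sub>R \<alpha>"
      using family_edge f by blast
    then have "m (root_reflection \<alpha> f) - m g = (m f - m g) + of_int r *\<^sub>R (- \<alpha>)"
      by (simp add: algebra_simps)
    moreover have "- \<alpha> \<in> pos h" using f pos_or_neg[OF reg(2)] simple_root by blast
    then have "(m f - m g) + of_int r *\<^sub>R (- \<alpha>) \<in> Qp h"
      using f r by (intro f(2) Qp_add[OF reg(2)] Qp_scale[OF reg(2)] Qp_pos[OF reg(2)]) auto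
    ultimately show "m (root_reflection \<alpha> f) - m g \<in> Qp h" by (simp only:)
  qed
  then show ?thesis using family_cong reg by metis
qed

end

subsection \<open>Moving lattice points by roots\<close>

lemma exists_regular: "\<exists>g. regular g"
proof -
  have "negligible (\<Union>\<alpha>\<in>\<Phi>. {h. \<alpha> \<bullet> h = 0})"
    using finite_roots root_nonzero by (intro negligible_Union) (auto intro!: negligible_hyperplane)
  then have "(\<Union>\<alpha>\<in>\<Phi>. {h. \<alpha> \<bullet> h = 0}) \<noteq> UNIV" using non_negligible_UNIV by metis
  then show ?thesis by (auto simp: regular_def)
qed

text \<open>Take h = y + e g with small e > 0: nonzero pairings with \<open>y\<close> keep their
  sign, and the vanishing ones take the sign given by \<open>g\<close>.\<close>

lemma exists_perturbation:
  assumes g: "regular g"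
  shows "\<exists>h. regular h \<and> (\<forall>\<beta>\<in>pos h. 0 \<le> y \<bullet> \<beta> \<and> (y \<bullet> \<beta> = 0 \<longrightarrow> \<beta> \<in> pos g))"
proof -
  have "\<forall>\<^sub>F e in at_right 0. \<beta> \<bullet> (y + e *\<^sub>R g) \<noteq> 0 \<and>
      (\<beta> \<bullet> (y + e *\<^sub>R g) > 0 \<longrightarrow> 0 \<le> y \<bullet> \<beta> \<and> (y \<bullet> \<beta> = 0 \<longrightarrow> \<beta> \<in> pos g))"
    if b: "\<beta> \<in> \<Phi>" for \<beta>
  proof -
    have lim: "((\<lambda>e. \<beta> \<bullet> (y + e *\<^sub>R g)) \<longlongrightarrow> \<beta> \<bullet> (y + 0 *\<^sub>R g)) (at_right 0)"
      by (intro tendsto_intros)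
    consider "y \<bullet> \<beta> > 0" | "y \<bullet> \<beta> < 0" | "y \<bullet> \<beta> = 0" by linarith
    then show ?thesis
    proof cases
      case 1
      then have "\<forall>\<^sub>F e in at_right 0. 0 < \<beta> \<bullet> (y + e *\<^sub>R g)"
        using lim by (intro order_tendstoD(1)[OF lim]) (simp add: inner_commute)
      then show ?thesis by eventually_elim (use 1 in auto)
    next
      case 2
      then have "\<forall>\<^sub>F e in at_right 0. \<beta> \<bullet> (y + e *\<^sub>R g) < 0"
        using lim by (intro order_tendstoD(2)[OF lim]) (simp add: inner_commute)
      then show ?thesis by eventually_elim (use 2 in auto)
    next
      case 3
      have "\<forall>\<^sub>F e::real in at_right 0. 0 < e" by (simp add: eventually_at_right_less)
      then show ?thesis
        by eventually_elim (use 3 b g in \<open>auto simp: inner_add inner_commute regular_def pos_def zero_less_mult_iff\<close>)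
    qed
  qed
  then have "\<forall>\<^sub>F e in at_right 0. \<forall>\<beta>\<in>\<Phi>. \<beta> \<bullet> (y + e *\<^sub>R g) \<noteq> 0 \<and>
      (\<beta> \<bullet> (y + e *\<^sub>R g) > 0 \<longrightarrow> 0 \<le> y \<bullet> \<beta> \<and> (y \<bullet> \<beta> = 0 \<longrightarrow> \<beta> \<in> pos g))"
    using finite_roots by (intro eventually_ball_finite) auto
  then obtain e :: real where "\<forall>\<beta>\<in>\<Phi>. \<beta> \<bullet> (y + e *\<^sub>R g) \<noteq> 0 \<and>
      (\<beta> \<bullet> (y + e *\<^sub>R g) > 0 \<longrightarrow> 0 \<le> y \<bullet> \<beta> \<and> (y \<bullet> \<beta> = 0 \<longrightarrow> \<beta> \<in> pos g))"
    using eventually_happens[of _ "at_right (0::real)"] by (auto simp: trivial_limit_at_right_real)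
  then show ?thesis by (intro exI[of _ "y + e *\<^sub>R g"]) (auto simp: regular_def pos_def)
qed

text \<open>A chamber whose closure contains \<open>y\<close>, with ties broken towards
  \<open>w\<close>. The choice of \<open>w\<close> is what matters in the applications.\<close>

lemma exists_lexicographic_chamber:
  obtains h where "regular h" "\<And>\<beta>. \<beta> \<in> pos h \<Longrightarrow> 0 \<le> y \<bullet> \<beta>"
    "\<And>\<beta>. \<beta> \<in> pos h \<Longrightarrow> y \<bullet> \<beta> = 0 \<Longrightarrow> 0 \<le> w \<bullet> \<beta>"
proof -
  obtain g where g: "regular g" using exists_regular by blast
  obtain g' where g': "regular g'" "\<forall>\<beta>\<in>pos g'. 0 \<le> w \<bullet> \<beta>"
    using exists_perturbation[OF g, of w] by blast
  show ?thesis using exists_perturbation[OF g'(1), of y] g'(2) that by blast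
qed

lemma Qp_uminus_chamber:
  assumes reg: "regular h" and v: "v \<in> Qp (- h)"
  shows "- v \<in> Qp h"
proof -
  have regm: "regular (- h)" using reg by (simp add: regular_def)
  have "- v = (\<Sum>\<alpha>\<in>simple (- h). coef (- h) v \<alpha> *\<^sub>R (- \<alpha>))"
    by (subst coef_expand[OF regm, of v]) (simp add: sum_negf)
  also have "\<dots> \<in> Qp h"
  proof (intro Qp_sum[OF reg] Qp_scale[OF reg] Qp_pos[OF reg])
    fix \<alpha> assume a: "\<alpha> \<in> simple (- h)"
    show "coef (- h) v \<alpha> \<in> \<int>" using coef_int[OF regm] Qp_in_Y[OF v] by blast
    show "0 \<le> coef (- h) v \<alpha>" using v a by (simp add: Qp_def)
    show "- \<alpha> \<in> pos h" using a simple_pos[OF a] uminus_root by (auto simp: pos_def)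
  qed
  finally show ?thesis .
qed

section \<open>Finiteness and induction on the norm\<close>

text \<open>The vertex at the opposite chamber \<open>- h\<close> bounds the coordinates from the
  other side, and they are integers.\<close>

lemma finite_lat: "finite (lat m)"
proof -
  obtain h where reg: "regular h" using exists_regular by blast
  have regm: "regular (- h)" using reg by (simp add: regular_def)
  define f where "f = (\<lambda>x. restrict (coef h (m h - x)) (simple h))"
  define B where "B = (\<lambda>\<alpha>. coef h (m h - m (- h)) \<alpha>)"
  have "f ` lat m \<subseteq> PiE (simple h) (\<lambda>\<alpha>. {k\<in>\<int>. \<bar>k\<bar> \<le> B \<alpha>})"
  proof
    fix z assume "z \<in> f ` lat m"
    then obtain x where x: "x \<in> lat m" "z = f x" by blast
    have 1: "m h - x \<in> Qp h" using latD[OF x(1) reg] .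
    have 2: "x - m (- h) \<in> Qp h"
      using Qp_uminus_chamber[OF reg latD[OF x(1) regm]] by simp
    have "0 \<le> coef h (m h - x) \<alpha> \<and> coef h (m h - x) \<alpha> \<le> B \<alpha>" if "\<alpha> \<in> simple h" for \<alpha>
      using 1 2 that by (auto simp: Qp_def B_def coef_diff reg)
    then show "z \<in> PiE (simple h) (\<lambda>\<alpha>. {k\<in>\<int>. \<bar>k\<bar> \<le> B \<alpha>})"
      using x(2) coef_int[OF reg Qp_in_Y[OF 1]] by (auto simp: f_def)
  qed
  then have fin: "finite (f ` lat m)"
    by (rule finite_subset) (intro finite_PiE finite_simple finite_abs_int_segment)
  have "inj_on f (lat m)"
  proof
    fix x y assume "f x = f y"
    then have "coef h (m h - x) \<alpha> = coef h (m h - y) \<alpha>" if "\<alpha> \<in> simple h" for \<alpha>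
      using that unfolding f_def by (metis restrict_apply')
    then have "m h - x = m h - y"
      using coef_expand[OF reg, of "m h - x"] coef_expand[OF reg, of "m h - y"] by simp
    then show "x = y" by simp
  qed
  with fin show ?thesis by (rule finite_imageD)
qed

lemma lat_induct [consumes 1, case_names outer]:
  assumes "x \<in> lat m"
    and "\<And>x. x \<in> lat m \<Longrightarrow> (\<And>z. z \<in> lat m \<Longrightarrow> x \<bullet> x < z \<bullet> z \<Longrightarrow> Q z) \<Longrightarrow> Q x"
  shows "Q x"
  using assms(1)
proof (induction "card {z\<in>lat m. x \<bullet> x < z \<bullet> z}" arbitrary: x rule: less_induct)
  case less
  show ?case
  proof (rule assms(2)[OF less.prems])
    fix z assume z: "z \<in> lat m" "x \<bullet> x < z \<bullet> z"
    have "card {y\<in>lat m. z \<bullet> z < y \<bullet> y} < card {y\<in>lat m. x \<bullet> x < y \<bullet> y}"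
      using z finite_lat by (intro psubset_card_mono) auto
    then show "Q z" using less.hyps z by blast
  qed
qed

lemma inner_add_root_greater:
  assumes "\<gamma> \<in> \<Phi>" "0 \<le> x \<bullet> \<gamma>" shows "x \<bullet> x < (x + \<gamma>) \<bullet> (x + \<gamma>)"
  using assms inner_root_pos[of \<gamma>] by (simp add: inner_add inner_commute del: inner_gt_zero_iff)

lemma dominant_if_simple:
  assumes "\<And>\<alpha>. \<alpha> \<in> simple h \<Longrightarrow> 0 \<le> y \<bullet> \<alpha>" "\<beta> \<in> pos h"
  shows "0 \<le> y \<bullet> \<beta>"
  using assms(2,1) by (induction rule: pos_induct) (auto simp: inner_add)

context
  fixes m assumes sf: "special_family m"
begin

lemma lat_int: assumes "x \<in> lat m" "\<beta> \<in> \<Phi>" shows "x \<bullet> coroot \<beta> \<in> \<int>"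
proof -
  obtain h where reg: "regular h" using exists_regular by blast
  have "m h \<bullet> coroot \<beta> \<in> \<int>" using family_int[OF sf reg assms(2)] .
  moreover have "(m h - x) \<bullet> coroot \<beta> \<in> \<int>"
    using Y_pairing_int Qp_in_Y latD[OF assms(1) reg] assms(2) by blast
  ultimately have "m h \<bullet> coroot \<beta> - (m h - x) \<bullet> coroot \<beta> \<in> \<int>" by (rule Ints_diff)
  then show ?thesis by (simp add: inner_diff)
qed

lemma lat_pairing_ge_1:
  "x \<in> lat m \<Longrightarrow> \<beta> \<in> \<Phi> \<Longrightarrow> 0 < x \<bullet> \<beta> \<Longrightarrow> 1 \<le> x \<bullet> coroot \<beta>"
  using lat_int Ints_pos_ge_1 inner_coroot_pos_iff by metis

text \<open>For \<open>x \<bullet> coroot \<alpha> = 1\<close> the result is the reflection of \<open>x\<close>; if \<open>\<alpha>\<close> is not simple for a suitable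
  chamber containing \<open>x\<close>, it is a sum of two shorter roots, which can be subtracted one by one.\<close>

lemma lat_diff_root:
  assumes "x \<in> lat m" "\<alpha> \<in> \<Phi>" "0 < x \<bullet> \<alpha>"
  shows "x - \<alpha> \<in> lat m"
  using assms
proof (induction "card {\<beta>\<in>\<Phi>. \<beta> \<bullet> \<beta> < \<alpha> \<bullet> \<alpha>}" arbitrary: \<alpha> x rule: less_induct)
  case less
  note x = less.prems(1) and aR = less.prems(2)
  have ge1: "1 \<le> x \<bullet> coroot \<alpha>" by (rule lat_pairing_ge_1[OF less.prems])
  show ?case
  proof (cases "x \<bullet> coroot \<alpha> = 1")
    case False
    have "x \<bullet> coroot \<alpha> - 1 \<ge> 1"
      using False ge1 lat_int[OF x aR] by (intro Ints_pos_ge_1) auto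
    then have "0 \<le> (x - \<alpha>) \<bullet> coroot \<alpha>" by (simp add: inner_diff root_coroot_self aR)
    then have ya: "0 \<le> (x - \<alpha>) \<bullet> \<alpha>" using inner_coroot_nonneg_iff[OF aR] by blast
    \<comment> \<open>Ties are broken towards \<alpha>, so that \<alpha> is positive on
      \<open>h\<close> even if it is orthogonal to \<open>x - \<alpha>\<close>.\<close>
    obtain h where h: "regular h" "\<And>\<beta>. \<beta> \<in> pos h \<Longrightarrow> 0 \<le> (x - \<alpha>) \<bullet> \<beta>"
      "\<And>\<beta>. \<beta> \<in> pos h \<Longrightarrow> (x - \<alpha>) \<bullet> \<beta> = 0 \<Longrightarrow> 0 \<le> \<alpha> \<bullet> \<beta>"
      using exists_lexicographic_chamber[of "x - \<alpha>" \<alpha>] by blast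
    have "\<alpha> \<in> pos h"
    proof (rule ccontr)
      assume "\<alpha> \<notin> pos h"
      then have n: "- \<alpha> \<in> pos h" using pos_or_neg[OF h(1) aR] by blast
      have "0 \<le> - ((x - \<alpha>) \<bullet> \<alpha>)" using h(2)[OF n] by simp
      with ya have "(x - \<alpha>) \<bullet> - \<alpha> = 0" by simp
      from h(3)[OF n this] inner_root_pos[OF aR] show False by simp
    qed
    then have "(m h - x) + \<alpha> \<in> Qp h" using latD[OF x h(1)] Qp_pos Qp_add h(1) by blast
    then show ?thesis
      by (intro dominant_in_lat[OF sf h(1) h(2)]) (simp_all add: algebra_simps)
  next
    case True
    then have xa: "2 * (x \<bullet> \<alpha>) = \<alpha> \<bullet> \<alpha>"
      using root_nonzero[OF aR] by (simp add: inner_coroot divide_eq_eq)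
    \<comment> \<open>Ties are broken towards \<open>- \<alpha>\<close>: a positive root orthogonal
      to \<open>x\<close> then makes no acute angle with \<alpha>. This forces both summands of a
      decomposition of \<alpha> to pair positively with \<open>x\<close>.\<close>
    obtain h where h: "regular h" "\<And>\<beta>. \<beta> \<in> pos h \<Longrightarrow> 0 \<le> x \<bullet> \<beta>"
      "\<And>\<beta>. \<beta> \<in> pos h \<Longrightarrow> x \<bullet> \<beta> = 0 \<Longrightarrow> 0 \<le> - \<alpha> \<bullet> \<beta>"
      using exists_lexicographic_chamber[of x "- \<alpha>"] by blast
    have apos: "\<alpha> \<in> pos h"
      using pos_or_neg[OF h(1) aR] h(2)[of "- \<alpha>"] less.prems(3) by auto
    show ?thesis
    proof (cases "\<alpha> \<in> simple h")
      case asimple: True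
      let ?g = "root_reflection \<alpha> h"
      have "x - \<alpha> = root_reflection \<alpha> x" using True by (simp add: root_reflection_def)
      moreover have "0 \<le> root_reflection \<alpha> x \<bullet> \<beta>" if "\<beta> \<in> pos ?g" for \<beta>
        using that pos_reflection[OF aR] h(2) by (simp add: root_reflection_self_adjoint)
      moreover have "m ?g - (x - \<alpha>) \<in> Qp ?g"
        using step[OF sf h(1) asimple latD[OF x h(1)], of 1] True by simp
      ultimately show ?thesis
        using dominant_in_lat[OF sf regular_reflection[OF aR h(1)], of "x - \<alpha>"] by simp
    next
      case False
      then obtain \<beta> \<gamma> where bg: "\<beta> \<in> pos h" "\<gamma> \<in> pos h" "\<alpha> = \<beta> + \<gamma>"
        using apos by (auto simp: simple_def)
      have nonzero: "x \<bullet> \<delta> > 0" if d: "\<delta> \<in> pos h" and e: "\<epsilon> \<in> pos h" and s: "\<alpha> = \<epsilon> + \<delta>" for \<delta> \<epsilon>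
      proof (rule ccontr)
        assume "\<not> x \<bullet> \<delta> > 0"
        then have x0: "x \<bullet> \<delta> = 0" using h(2)[OF d] by linarith
        then have ad: "\<alpha> \<bullet> \<delta> \<le> 0" using h(3)[OF d] by simp
        have xe: "2 * (x \<bullet> \<epsilon>) = \<alpha> \<bullet> \<alpha>" using xa x0 s by (simp add: inner_add)
        then have "x \<bullet> \<epsilon> > 0" using inner_root_pos[OF aR] by linarith
        then have "1 \<le> x \<bullet> coroot \<epsilon>" using lat_pairing_ge_1[OF x pos_root[OF e]] by blast
        then have "\<epsilon> \<bullet> \<epsilon> \<le> 2 * (x \<bullet> \<epsilon>)" using inner_root_pos[OF pos_root[OF e]]
          by (simp add: inner_coroot le_divide_eq del: inner_gt_zero_iff)
        then have "\<epsilon> \<bullet> \<epsilon> \<le> \<alpha> \<bullet> \<alpha>" using xe by simp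
        moreover have "\<epsilon> = \<alpha> - \<delta>" using s by simp
        ultimately have "\<delta> \<bullet> \<delta> \<le> 0" using ad by (simp add: inner_diff inner_commute)
        with inner_root_pos[OF pos_root[OF d]] show False by linarith
      qed
      have xb: "x \<bullet> \<beta> > 0" and xg: "x \<bullet> \<gamma> > 0"
        using nonzero bg by (auto simp: add.commute)
      have le: "\<delta> \<bullet> \<delta> \<le> 2 * (x \<bullet> \<delta>)" if "\<delta> \<in> pos h" "x \<bullet> \<delta> > 0" for \<delta>
        using lat_pairing_ge_1[OF x pos_root[OF that(1)] that(2)] inner_root_pos[OF pos_root[OF that(1)]]
        by (simp add: inner_coroot le_divide_eq del: inner_gt_zero_iff)
      have short: "\<beta> \<bullet> \<beta> + \<gamma> \<bullet> \<gamma> \<le> \<alpha> \<bullet> \<alpha>"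
        using le[OF bg(1) xb] le[OF bg(2) xg] xa bg(3) by (simp add: inner_add)
      have bn: "\<beta> \<bullet> \<beta> > 0" and gn: "\<gamma> \<bullet> \<gamma> > 0" using bg inner_root_pos pos_root by blast+
      have IH: "y - \<delta> \<in> lat m" if "y \<in> lat m" "\<delta> \<in> \<Phi>" "\<delta> \<bullet> \<delta> < \<alpha> \<bullet> \<alpha>" "0 < y \<bullet> \<delta>" for y \<delta>
      proof (rule less.hyps)
        show "card {\<beta>\<in>\<Phi>. \<beta> \<bullet> \<beta> < \<delta> \<bullet> \<delta>} < card {\<beta>\<in>\<Phi>. \<beta> \<bullet> \<beta> < \<alpha> \<bullet> \<alpha>}"
          using that finite_roots by (intro psubset_card_mono) auto
      qed (use that in auto)
      have two: "x - \<alpha> \<in> lat m"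
        if "\<delta> \<in> pos h" "\<epsilon> \<in> pos h" "\<alpha> = \<delta> + \<epsilon>" "0 < (x - \<delta>) \<bullet> \<epsilon>" "0 < x \<bullet> \<delta>"
          "\<delta> \<bullet> \<delta> < \<alpha> \<bullet> \<alpha>" "\<epsilon> \<bullet> \<epsilon> < \<alpha> \<bullet> \<alpha>" for \<delta> \<epsilon>
      proof -
        have "x - \<delta> \<in> lat m" using IH x that pos_root by blast
        then have "x - \<delta> - \<epsilon> \<in> lat m" using IH that pos_root by blast
        then show ?thesis using that(3) by (simp add: algebra_simps)
      qed
      have "\<beta> \<noteq> \<gamma>"
      proof
        assume "\<beta> = \<gamma>"
        then have "2 *\<^sub>R \<gamma> \<in> \<Phi>" using aR bg(3) by (simp add: scaleR_2)
        with reduced pos_root[OF bg(2)] show False by (fastforce simp: reduced_roots_def)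
      qed
      then have p: "0 < (\<beta> - \<gamma>) \<bullet> (\<beta> - \<gamma>)" by simp
      \<comment> \<open>Subtracting one summand may destroy positivity for the other. The identity
        shows that this cannot happen in both orders.\<close>
      have e: "2 * ((x - \<beta>) \<bullet> \<gamma> + (x - \<gamma>) \<bullet> \<beta>) = (\<beta> - \<gamma>) \<bullet> (\<beta> - \<gamma>)"
        using xa bg(3) by (simp add: inner_add inner_diff inner_commute algebra_simps)
      have "0 < 2 * ((x - \<beta>) \<bullet> \<gamma> + (x - \<gamma>) \<bullet> \<beta>)" unfolding e by (rule p)
      then have "0 < (x - \<beta>) \<bullet> \<gamma> \<or> 0 < (x - \<gamma>) \<bullet> \<beta>" by argo
      moreover have "\<beta> \<bullet> \<beta> < \<alpha> \<bullet> \<alpha>" "\<gamma> \<bullet> \<gamma> < \<alpha> \<bullet> \<alpha>" using short bn gn by linarith+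
      moreover have "\<alpha> = \<gamma> + \<beta>" using bg(3) by simp
      ultimately show ?thesis using two bg xb xg by blast
    qed
  qed
qed

lemma lat_add_root:
  "x \<in> lat m \<Longrightarrow> \<alpha> \<in> \<Phi> \<Longrightarrow> x \<bullet> \<alpha> < 0 \<Longrightarrow> x + \<alpha> \<in> lat m"
  using lat_diff_root[of x "- \<alpha>"] uminus_root by simp

text \<open>Choose \<gamma> with the largest pairing with \<open>h\<close>. If
  \<open>x + \<gamma>\<close> paired negatively with a simple \<alpha>, then
  \<open>\<gamma> + \<alpha>\<close> would be a root; maximality makes the \<alpha>-coordinate of
  \<open>m h - x - \<gamma>\<close> vanish, so this vector pairs non-positively with \<alpha>, and
  dominance of \<open>m h\<close> gives a contradiction.\<close>

lemma exists_maximal_step: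
  assumes x: "x \<in> lat m" and reg: "regular h" and dom: "\<And>\<beta>. \<beta> \<in> pos h \<Longrightarrow> 0 \<le> x \<bullet> \<beta>"
    and ne: "x \<noteq> m h"
  obtains \<gamma> where "\<gamma> \<in> pos h" "x + \<gamma> \<in> lat m" "\<And>\<beta>. \<beta> \<in> pos h \<Longrightarrow> 0 \<le> (x + \<gamma>) \<bullet> \<beta>"
    "\<And>\<delta>. \<delta> \<in> pos h \<Longrightarrow> \<gamma> + \<delta> \<in> \<Phi> \<Longrightarrow> x + (\<gamma> + \<delta>) \<notin> lat m"
proof -
  define u where "u = m h - x"
  have u: "u \<in> Qp h" using latD[OF x reg] by (simp add: u_def)
  define A where "A = {\<gamma>\<in>pos h. u - \<gamma> \<in> Qp h}"
  have finA: "finite A" using finite_pos by (simp add: A_def)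
  have "A \<noteq> {}"
  proof -
    have "u \<noteq> 0" using ne by (simp add: u_def)
    then have "\<exists>\<alpha>\<in>simple h. coef h u \<alpha> \<noteq> 0"
      using coef_expand[OF reg, of u] by (metis (no_types, lifting) scale_eq_0_iff sum.neutral)
    then obtain \<alpha> where "\<alpha> \<in> simple h" "coef h u \<alpha> \<noteq> 0" by blast
    then have "\<alpha> \<in> A" using Qp_coef_ge_1[OF reg u] simple_pos by (simp add: A_def)
    then show ?thesis by blast
  qed
  define \<gamma> where "\<gamma> = arg_min_on (\<lambda>\<delta>. - (\<delta> \<bullet> h)) A"
  have g: "\<gamma> \<in> A" unfolding \<gamma>_def using finA \<open>A \<noteq> {}\<close> by (rule arg_min_if_finite(1))
  have max: "\<delta> \<bullet> h \<le> \<gamma> \<bullet> h" if "\<delta> \<in> A" for \<delta>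
    using arg_min_least[OF finA \<open>A \<noteq> {}\<close> that, of "\<lambda>\<delta>. - (\<delta> \<bullet> h)"] by (simp add: \<gamma>_def)
  have gp: "\<gamma> \<in> pos h" and ug: "u - \<gamma> \<in> Qp h" using g by (auto simp: A_def)
  have notA: "u - (\<gamma> + \<delta>) \<notin> Qp h" if "\<delta> \<in> pos h" "\<gamma> + \<delta> \<in> \<Phi>" for \<delta>
    using max[of "\<gamma> + \<delta>"] pos_add[OF gp that] pos_inner[OF that(1)]
    by (auto simp: A_def inner_add)
  have mx: "m h - (x + \<gamma>) = u - \<gamma>" by (simp add: u_def)
  have dom': "0 \<le> (x + \<gamma>) \<bullet> \<alpha>" if a: "\<alpha> \<in> simple h" for \<alpha>
  proof (rule ccontr)
    assume neg: "\<not> ?thesis"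
    have "\<gamma> \<bullet> \<alpha> < 0" using neg dom[OF simple_pos[OF a]] by (simp add: inner_add)
    moreover have "\<gamma> \<noteq> - \<alpha>" using gp uminus_pos[OF simple_pos[OF a]] by auto
    ultimately have "\<gamma> + \<alpha> \<in> \<Phi>" using sum_root pos_root[OF gp] simple_root[OF a] by blast
    from notA[OF simple_pos[OF a] this] have "u - \<gamma> - \<alpha> \<notin> Qp h" by (simp add: algebra_simps)
    then have c0: "coef h (u - \<gamma>) \<alpha> = 0" using Qp_coef_ge_1[OF reg ug a] by blast
    have "(u - \<gamma>) \<bullet> \<alpha> = (\<Sum>\<beta>\<in>simple h. coef h (u - \<gamma>) \<beta> * (\<beta> \<bullet> \<alpha>))"
      by (subst coef_expand[OF reg, of "u - \<gamma>"]) (simp add: inner_sum_left)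
    also have "\<dots> \<le> 0"
    proof (rule sum_nonpos)
      fix \<beta> assume b: "\<beta> \<in> simple h"
      show "coef h (u - \<gamma>) \<beta> * (\<beta> \<bullet> \<alpha>) \<le> 0"
        using c0 simple_obtuse[OF reg b a] ug b
        by (cases "\<beta> = \<alpha>") (auto simp: Qp_def mult_nonneg_nonpos)
    qed
    finally have "(u - \<gamma>) \<bullet> \<alpha> \<le> 0" .
    moreover have "x + \<gamma> = m h - (u - \<gamma>)" by (simp add: u_def)
    ultimately have "0 \<le> (x + \<gamma>) \<bullet> \<alpha>"
      using family_dominant[OF sf reg simple_pos[OF a]] by (simp add: inner_diff_left inner_add_left)
    with neg show False by simp
  qed
  show ?thesis
  proof (rule that[OF gp])
    show dom'': "0 \<le> (x + \<gamma>) \<bullet> \<beta>" if "\<beta> \<in> pos h" for \<beta>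
      using dominant_if_simple dom' that by blast
    show "x + \<gamma> \<in> lat m"
      using dominant_in_lat[OF sf reg dom''] mx ug by simp
    fix \<delta> assume d: "\<delta> \<in> pos h" "\<gamma> + \<delta> \<in> \<Phi>"
    show "x + (\<gamma> + \<delta>) \<notin> lat m"
    proof
      assume "x + (\<gamma> + \<delta>) \<in> lat m"
      from latD[OF this reg] notA[OF d] show False by (simp add: u_def algebra_simps)
    qed
  qed
qed

text \<open>Dual form of: \<open>m h - x\<close> lies in the cone of the positive roots that can be
  added to \<open>x\<close>. After a maximal step \<gamma>, a root \<delta> that can be added to
  \<open>x + \<gamma>\<close> has \<open>\<gamma> + \<delta>\<close> not a root, hence pairs
  non-negatively with \<gamma>. So \<gamma> can be taken away again from
  \<open>x + \<gamma> + \<delta>\<close>, and \<delta> could already be added to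
  \<open>x\<close>.\<close>

lemma inner_difference_nonpos:
  assumes "x \<in> lat m" and reg: "regular h" and "\<And>\<beta>. \<beta> \<in> pos h \<Longrightarrow> 0 \<le> x \<bullet> \<beta>"
    and "\<And>\<gamma>. \<gamma> \<in> pos h \<Longrightarrow> x + \<gamma> \<in> lat m \<Longrightarrow> w \<bullet> \<gamma> \<le> 0"
  shows "w \<bullet> (m h - x) \<le> 0"
  using assms(1,3,4)
proof (induction rule: lat_induct)
  case (outer x)
  show ?case
  proof (cases "x = m h")
    case False
    then obtain \<gamma> where g: "\<gamma> \<in> pos h" "x + \<gamma> \<in> lat m" "\<And>\<beta>. \<beta> \<in> pos h \<Longrightarrow> 0 \<le> (x + \<gamma>) \<bullet> \<beta>"
      "\<And>\<delta>. \<delta> \<in> pos h \<Longrightarrow> \<gamma> + \<delta> \<in> \<Phi> \<Longrightarrow> x + (\<gamma> + \<delta>) \<notin> lat m"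
      using exists_maximal_step[OF outer.hyps reg outer.prems(1)] by blast
    have "w \<bullet> (m h - (x + \<gamma>)) \<le> 0"
    proof (rule outer.IH[OF g(2) _ g(3)])
      show "x \<bullet> x < (x + \<gamma>) \<bullet> (x + \<gamma>)"
        using inner_add_root_greater pos_root[OF g(1)] outer.prems(1)[OF g(1)] by blast
      fix \<delta> assume d: "\<delta> \<in> pos h" "x + \<gamma> + \<delta> \<in> lat m"
      have "\<gamma> + \<delta> \<notin> \<Phi>" using g(4)[OF d(1)] d(2) by (auto simp: add.assoc)
      then have "0 \<le> \<gamma> \<bullet> \<delta>"
        using sum_root[OF pos_root[OF g(1)] pos_root[OF d(1)]] uminus_pos[OF d(1)] g(1)
        by (metis not_less)
      then have "0 < (x + \<gamma> + \<delta>) \<bullet> \<gamma>"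
        using outer.prems(1)[OF g(1)] inner_root_pos[OF pos_root[OF g(1)]]
        by (simp add: inner_add inner_commute del: inner_gt_zero_iff)
      from lat_diff_root[OF d(2) pos_root[OF g(1)] this] have "x + \<delta> \<in> lat m"
        by (simp add: algebra_simps)
      then show "w \<bullet> \<delta> \<le> 0" using outer.prems(2) d(1) by blast
    qed
    moreover have "w \<bullet> \<gamma> \<le> 0" using outer.prems(2) g by blast
    ultimately show ?thesis by (simp add: inner_diff inner_add)
  qed simp
qed

end

end

subsection \<open>Tuples of lattice points\<close>

locale root_tuples = root_sys \<Phi> for \<Phi> :: "'a::euclidean_space set" +
  fixes n :: nat and P :: "nat \<Rightarrow> 'a set" and M :: "nat \<Rightarrow> 'a \<Rightarrow> 'a"
  assumes family: "i \<in> {1..n} \<Longrightarrow> special_family (M i)"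
    and lattice_points_eq: "i \<in> {1..n} \<Longrightarrow> lattice_points \<Phi> (P i) = lat (M i)"
begin

abbreviation tuples :: "(nat \<Rightarrow> 'a) set" where "tuples \<equiv> lattice_tuples \<Phi> n P"

definition total :: "(nat \<Rightarrow> 'a) \<Rightarrow> 'a" where "total t = (\<Sum>i=1..n. t i)"

abbreviation equivalent :: "(nat \<Rightarrow> 'a) \<Rightarrow> (nat \<Rightarrow> 'a) \<Rightarrow> bool" (infix "\<sim>\<sim>" 50) where
  "s \<sim>\<sim> t \<equiv> root_move_equiv \<Phi> n P s t"

text \<open>The vertices of the Minkowski sum; \<open>lat sum_family\<close> stands in for its
  lattice points.\<close>

definition sum_family :: "'a \<Rightarrow> 'a" where "sum_family h = (\<Sum>i=1..n. M i h)"

lemma special_sum_family: "special_family sum_family"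
  unfolding special_family_def
proof (intro allI impI conjI ballI)
  fix h assume reg: "regular h"
  show "sum_family h \<bullet> coroot \<beta> \<in> \<int>" if "\<beta> \<in> \<Phi>" for \<beta>
    using family_int[OF family reg that] by (auto simp: sum_family_def inner_sum_left intro!: Ints_sum)
  show "0 \<le> sum_family h \<bullet> \<beta>" if "\<beta> \<in> pos h" for \<beta>
    using family_dominant[OF family reg that] by (auto simp: sum_family_def inner_sum_left intro!: sum_nonneg)
  show "sum_family h' = sum_family h" if "regular h'" "pos h' = pos h" for h'
    using family_cong[OF family reg that] by (simp add: sum_family_def)
  fix \<alpha> assume a: "\<alpha> \<in> simple h"
  have "\<exists>r::int. 0 \<le> r \<and> M i h - M i (root_reflection \<alpha> h) = of_int r *\<^sub>R \<alpha>" if "i \<in> {1..n}" for i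
    using family_edge[OF family[OF that] reg a] by blast
  then obtain r :: "nat \<Rightarrow> int" where
    r: "\<And>i. i \<in> {1..n} \<Longrightarrow> 0 \<le> r i \<and> M i h - M i (root_reflection \<alpha> h) = of_int (r i) *\<^sub>R \<alpha>"
    by metis
  have "sum_family h - sum_family (root_reflection \<alpha> h) = (\<Sum>i=1..n. of_int (r i) *\<^sub>R \<alpha>)"
    using r by (simp add: sum_family_def sum_subtractf[symmetric])
  also have "\<dots> = of_int (\<Sum>i=1..n. r i) *\<^sub>R \<alpha>" by (simp add: scaleR_sum_left)
  finally show "\<exists>r::int. 0 \<le> r \<and> sum_family h - sum_family (root_reflection \<alpha> h) = of_int r *\<^sub>R \<alpha>"
    using r by (intro exI[of _ "\<Sum>i=1..n. r i"]) (auto intro: sum_nonneg)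
qed

lemma tuples_eq: "tuples = PiE {1..n} (\<lambda>i. lat (M i))"
  unfolding lattice_tuples_def by (intro PiE_cong lattice_points_eq)

lemma tupleD: "t \<in> tuples \<Longrightarrow> i \<in> {1..n} \<Longrightarrow> t i \<in> lat (M i)"
  unfolding tuples_eq by (rule PiE_mem)

lemma tuple_update: "t \<in> tuples \<Longrightarrow> i \<in> {1..n} \<Longrightarrow> v \<in> lat (M i) \<Longrightarrow> t(i := v) \<in> tuples"
  unfolding tuples_eq using PiE_fun_upd[of v "\<lambda>i. lat (M i)" i t "{1..n}"] by (simp add: insert_absorb)

lemma total_update: "i \<in> {1..n} \<Longrightarrow> total (t(i := v)) = total t - t i + v"
  using sum.remove[of "{1..n}" i t] sum.remove[of "{1..n}" i "t(i := v)"]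
  by (simp add: total_def)

lemma total_lat: assumes "t \<in> tuples" shows "total t \<in> lat sum_family"
  unfolding lat_def
proof (intro CollectI allI impI)
  fix h assume reg: "regular h"
  have "sum_family h - total t = (\<Sum>i=1..n. M i h - t i)"
    by (simp add: sum_family_def total_def sum_subtractf)
  also have "\<dots> \<in> Qp h" using latD[OF tupleD[OF assms] reg] by (intro Qp_sum[OF reg]) auto
  finally show "sum_family h - total t \<in> Qp h" .
qed

lemma equivalent_refl: "t \<sim>\<sim> t"
  by (simp add: root_move_equiv_def)

lemma equivalent_sym: "s \<sim>\<sim> t \<Longrightarrow> t \<sim>\<sim> s"
  unfolding root_move_equiv_def by (rule equivclp_sym)

lemma equivalent_trans [trans]: "s \<sim>\<sim> t \<Longrightarrow> t \<sim>\<sim> u \<Longrightarrow> s \<sim>\<sim> u"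
  unfolding root_move_equiv_def by (rule equivclp_trans)

lemma equivalent_move:
  assumes "t \<in> tuples" "\<beta> \<in> \<Phi>" "i \<in> {1..n}" "j \<in> {1..n}" "i \<noteq> j"
    "t i + \<beta> \<in> lat (M i)" "t j - \<beta> \<in> lat (M j)"
  shows "t \<sim>\<sim> t(i := t i + \<beta>, j := t j - \<beta>)"
proof -
  have "root_move \<Phi> n P t (t(i := t i + \<beta>, j := t j - \<beta>))"
    unfolding root_move_def using assms lattice_points_eq by blast
  then show ?thesis unfolding root_move_equiv_def by (rule r_into_equivclp[of "root_move \<Phi> n P"])
qed

lemma exists_index:
  assumes "0 < total t \<bullet> \<beta>"
  obtains k where "k \<in> {1..n}" "0 < t k \<bullet> \<beta>"
proof -
  have "\<not> (\<forall>k\<in>{1..n}. t k \<bullet> \<beta> \<le> 0)"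
    using assms sum_nonpos[of "{1..n}" "\<lambda>k. t k \<bullet> \<beta>"] by (force simp: total_def inner_sum_left)
  with that show ?thesis by force
qed

section \<open>Lowering a tuple by a root\<close>

lemma tuple_diff_root:
  "t \<in> tuples \<Longrightarrow> k \<in> {1..n} \<Longrightarrow> \<beta> \<in> \<Phi> \<Longrightarrow> 0 < t k \<bullet> \<beta> \<Longrightarrow> t k - \<beta> \<in> lat (M k)"
  using lat_diff_root family tupleD by blast

text \<open>Putting \<beta> back at \<open>i\<close> while removing it at \<open>j\<close> is itself
  a root move.\<close>

lemma down_same:
  assumes "t \<in> tuples" "\<beta> \<in> \<Phi>" "i \<in> {1..n}" "j \<in> {1..n}"
    "t i - \<beta> \<in> lat (M i)" "t j - \<beta> \<in> lat (M j)"
  shows "t(i := t i - \<beta>) \<sim>\<sim> t(j := t j - \<beta>)"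
proof (cases "i = j")
  case False
  let ?s = "t(i := t i - \<beta>)"
  have "?s \<sim>\<sim> ?s(i := ?s i + \<beta>, j := ?s j - \<beta>)"
    using assms False tupleD by (intro equivalent_move tuple_update) auto
  also have "?s(i := ?s i + \<beta>, j := ?s j - \<beta>) = t(j := t j - \<beta>)"
    using False by auto
  finally show ?thesis .
qed (simp add: equivalent_refl)

text \<open>If some entry can be lowered both in \<open>t\<close> and in \<open>s\<close>, the move
  by \<gamma> commutes with the lowering there. Otherwise the entries that can be lowered are the
  two ends of the move, and the results coincide or differ by a move along the difference of two
  roots.\<close>

lemma down_move:
  assumes t: "t \<in> tuples" and gR: "\<gamma> \<in> \<Phi>" and ij: "i \<in> {1..n}" "j \<in> {1..n}" "i \<noteq> j"
    and mv: "t i + \<gamma> \<in> lat (M i)" "t j - \<gamma> \<in> lat (M j)"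
    and s: "s = t(i := t i + \<gamma>, j := t j - \<gamma>)"
    and bR: "\<beta> \<in> \<Phi>" and b: "0 < total t \<bullet> \<beta>"
    and k: "k \<in> {1..n}" "t k - \<beta> \<in> lat (M k)" and l: "l \<in> {1..n}" "s l - \<beta> \<in> lat (M l)"
  shows "t(k := t k - \<beta>) \<sim>\<sim> s(l := s l - \<beta>)"
proof -
  have sT: "s \<in> tuples" unfolding s using t ij mv by (intro tuple_update) auto
  have tot: "total s = total t" unfolding s using ij by (simp add: total_update)
  have *: "\<exists>k\<in>{1..n}. \<exists>l\<in>{1..n}. t k - \<beta> \<in> lat (M k) \<and> s l - \<beta> \<in> lat (M l) \<and>
      t(k := t k - \<beta>) \<sim>\<sim> s(l := s l - \<beta>)"
  proof (cases "\<exists>k\<in>{1..n}. t k - \<beta> \<in> lat (M k) \<and> s k - \<beta> \<in> lat (M k)")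
    case True
    then obtain k where k: "k \<in> {1..n}" "t k - \<beta> \<in> lat (M k)" "s k - \<beta> \<in> lat (M k)" by blast
    let ?u = "t(k := t k - \<beta>)"
    have "?u i + \<gamma> = (if k = i then s k - \<beta> else t i + \<gamma>)"
      "?u j - \<gamma> = (if k = j then s k - \<beta> else t j - \<gamma>)"
      using ij by (auto simp: s algebra_simps)
    then have "?u i + \<gamma> \<in> lat (M i)" "?u j - \<gamma> \<in> lat (M j)"
      using k(3) mv by presburger+
    then have "?u \<sim>\<sim> ?u(i := ?u i + \<gamma>, j := ?u j - \<gamma>)"
      by (intro equivalent_move tuple_update t k gR ij)
    also have "?u(i := ?u i + \<gamma>, j := ?u j - \<gamma>) = s(k := s k - \<beta>)"
      using ij by (auto simp: s algebra_simps)
    finally show ?thesis using k by blast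
  next
    case False
    obtain k where k: "k \<in> {1..n}" "0 < t k \<bullet> \<beta>" using exists_index[OF b] by blast
    obtain l where l: "l \<in> {1..n}" "0 < s l \<bullet> \<beta>" using exists_index[of s \<beta>] b tot by auto
    have k': "t k - \<beta> \<in> lat (M k)" and l': "s l - \<beta> \<in> lat (M l)"
      using tuple_diff_root t sT k l bR by auto
    have other: "s p = t p" if "p \<notin> {i, j}" for p using that by (simp add: s)
    have "k \<in> {i, j}" using False k(1) k' other[of k] by metis
    moreover have "l \<in> {i, j}" using False l(1) l' other[of l] by metis
    moreover have "k \<noteq> l" using False k(1) k' l' by auto
    \<comment> \<open>Both orientations at once: \<delta> is \<gamma> or its negative, namely the
      change at the entry \<open>l\<close>, which can be lowered in \<open>s\<close> but not in
      \<open>t\<close>. Hence \<open>t l\<close> does not pair positively with \<beta>, and \<delta>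
      must.\<close>
    moreover have core: "\<exists>k\<in>{1..n}. \<exists>l\<in>{1..n}. t k - \<beta> \<in> lat (M k) \<and> s l - \<beta> \<in> lat (M l) \<and>
      t(k := t k - \<beta>) \<sim>\<sim> s(l := s l - \<beta>)"
      if d: "\<delta> \<in> \<Phi>" and sl: "s l = t l + \<delta>" "s k = t k - \<delta>" "s = t(l := t l + \<delta>, k := t k - \<delta>)" "k \<noteq> l" for \<delta>
    proof -
      have "\<not> 0 < t l \<bullet> \<beta>" using False tuple_diff_root[OF t l(1) bR] l l' by blast
      then have db: "0 < \<delta> \<bullet> \<beta>" using l(2) sl by (simp add: inner_add)
      show ?thesis
      proof (cases "\<delta> = \<beta>")
        case True
        have "t(k := t k - \<beta>) = s(l := s l - \<beta>)" using sl True by auto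
        then show ?thesis using k l k' l' equivalent_refl by metis
      next
        case False
        then have dR: "\<delta> - \<beta> \<in> \<Phi>" using diff_root d bR db by blast
        let ?u = "t(k := t k - \<beta>)"
        have "?u \<sim>\<sim> ?u(l := ?u l + (\<delta> - \<beta>), k := ?u k - (\<delta> - \<beta>))"
          using t k l k' l' dR sl tupleD[OF sT k(1)]
          by (intro equivalent_move tuple_update) (auto simp: algebra_simps)
        also have "?u(l := ?u l + (\<delta> - \<beta>), k := ?u k - (\<delta> - \<beta>)) = s(l := s l - \<beta>)"
          using sl by (auto simp: algebra_simps)
        finally show ?thesis using k l k' l' by blast
      qed
    qed
    ultimately consider "l = i" "k = j" | "l = j" "k = i" by blast
    then show ?thesis
    proof cases
      case 1
      show ?thesis by (rule core[OF gR]) (use 1 ij s in simp_all)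
    next
      case 2
      show ?thesis by (rule core[OF uminus_root[OF gR]]) (use 2 ij s in \<open>simp_all add: fun_upd_twist\<close>)
    qed
  qed
  then obtain k' l' where kl: "k' \<in> {1..n}" "l' \<in> {1..n}" "t k' - \<beta> \<in> lat (M k')" "s l' - \<beta> \<in> lat (M l')"
    "t(k' := t k' - \<beta>) \<sim>\<sim> s(l' := s l' - \<beta>)" by blast
  have "t(k := t k - \<beta>) \<sim>\<sim> t(k' := t k' - \<beta>)" using down_same t bR k kl by blast
  also note kl(5)
  also have "s(l' := s l' - \<beta>) \<sim>\<sim> s(l := s l - \<beta>)" using down_same sT bR l kl by blast
  finally show ?thesis .
qed

lemma root_moveE:
  assumes "root_move \<Phi> n P t s"
  obtains \<gamma> i j where "t \<in> tuples" "\<gamma> \<in> \<Phi>" "i \<in> {1..n}" "j \<in> {1..n}" "i \<noteq> j"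
    "t i + \<gamma> \<in> lat (M i)" "t j - \<gamma> \<in> lat (M j)" "s = t(i := t i + \<gamma>, j := t j - \<gamma>)"
proof -
  obtain \<gamma> i j where *: "t \<in> tuples" "\<gamma> \<in> \<Phi>" "i \<in> {1..n}" "j \<in> {1..n}" "i \<noteq> j"
    "t i + \<gamma> \<in> lattice_points \<Phi> (P i)" "t j - \<gamma> \<in> lattice_points \<Phi> (P j)"
    "s = t(i := t i + \<gamma>, j := t j - \<gamma>)"
    using assms unfolding root_move_def by blast
  from *(6,7) have "t i + \<gamma> \<in> lat (M i)" "t j - \<gamma> \<in> lat (M j)"
    unfolding lattice_points_eq[OF *(3)] lattice_points_eq[OF *(4)] .
  with * that show ?thesis by blast
qed

lemma down_root_move:
  assumes mv: "root_move \<Phi> n P t s" and bR: "\<beta> \<in> \<Phi>" and b: "0 < total t \<bullet> \<beta>"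
    and k: "k \<in> {1..n}" "t k - \<beta> \<in> lat (M k)" and l: "l \<in> {1..n}" "s l - \<beta> \<in> lat (M l)"
  shows "t(k := t k - \<beta>) \<sim>\<sim> s(l := s l - \<beta>)"
  using mv
proof (rule root_moveE)
  fix \<gamma> i j
  assume "t \<in> tuples" "\<gamma> \<in> \<Phi>" "i \<in> {1..n}" "j \<in> {1..n}" "i \<noteq> j"
    "t i + \<gamma> \<in> lat (M i)" "t j - \<gamma> \<in> lat (M j)" "s = t(i := t i + \<gamma>, j := t j - \<gamma>)"
  from down_move[OF this bR b k l] show ?thesis .
qed

lemma root_move_props:
  assumes "root_move \<Phi> n P t s"
  shows "t \<in> tuples" "s \<in> tuples" "total s = total t"
proof -
  obtain \<gamma> i j where ij: "t \<in> tuples" "i \<in> {1..n}" "j \<in> {1..n}" "i \<noteq> j" "t i + \<gamma> \<in> lat (M i)"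
      "t j - \<gamma> \<in> lat (M j)" "s = t(i := t i + \<gamma>, j := t j - \<gamma>)"
    using root_moveE[OF assms] by metis
  show "t \<in> tuples" by fact
  show "s \<in> tuples" unfolding ij(7) using ij by (intro tuple_update) auto
  show "total s = total t" unfolding ij(7) using ij(2-4) by (simp add: total_update)
qed

text \<open>Lowering by \<beta> thus acts on classes. Along a chain of moves the entry is chosen
  anew at each tuple; the positive pairing of the common sum with \<beta> guarantees one.\<close>

lemma down_equivalent:
  assumes "t \<sim>\<sim> s" and t: "t \<in> tuples" and bR: "\<beta> \<in> \<Phi>" and b: "0 < total t \<bullet> \<beta>"
    and k: "k \<in> {1..n}" "t k - \<beta> \<in> lat (M k)" and l: "l \<in> {1..n}" "s l - \<beta> \<in> lat (M l)"
  shows "t(k := t k - \<beta>) \<sim>\<sim> s(l := s l - \<beta>)"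
proof -
  have "s \<in> tuples \<and> total s = total t \<and>
      (\<forall>l\<in>{1..n}. s l - \<beta> \<in> lat (M l) \<longrightarrow> t(k := t k - \<beta>) \<sim>\<sim> s(l := s l - \<beta>))"
    using assms(1)[unfolded root_move_equiv_def]
  proof (induction rule: equivclp_induct)
    case base
    then show ?case using down_same[OF t bR k(1) _ k(2)] t by blast
  next
    case (step y z)
    have yT: "y \<in> tuples" and ty: "total y = total t"
      and ydown: "\<And>l. l \<in> {1..n} \<Longrightarrow> y l - \<beta> \<in> lat (M l) \<Longrightarrow> t(k := t k - \<beta>) \<sim>\<sim> y(l := y l - \<beta>)"
      using step.IH by blast+
    have b_y: "0 < total y \<bullet> \<beta>" using b ty by simp
    obtain j where j: "j \<in> {1..n}" "0 < y j \<bullet> \<beta>" using exists_index[OF b_y] by blast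
    then have j': "y j - \<beta> \<in> lat (M j)" using tuple_diff_root bR yT by blast
    have z: "z \<in> tuples \<and> total z = total y"
      using step.hyps(2) root_move_props[of y z] root_move_props[of z y] by auto
    then have bz: "0 < total z \<bullet> \<beta>" using b_y by simp
    have down: "t(k := t k - \<beta>) \<sim>\<sim> z(l := z l - \<beta>)"
      if l: "l \<in> {1..n}" "z l - \<beta> \<in> lat (M l)" for l
    proof -
      have "t(k := t k - \<beta>) \<sim>\<sim> y(j := y j - \<beta>)" using ydown j j' by blast
      also have "y(j := y j - \<beta>) \<sim>\<sim> z(l := z l - \<beta>)"
        using step.hyps(2)
      proof
        assume "root_move \<Phi> n P y z"
        then show ?thesis by (rule down_root_move[where t = y and s = z, OF _ bR b_y j(1) j' l])
      next
        assume "root_move \<Phi> n P z y"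
        from down_root_move[where t = z and s = y, OF this bR bz l j(1) j'] show ?thesis by (rule equivalent_sym)
      qed
      finally show ?thesis .
    qed
    show ?case using z ty by (intro conjI ballI impI down) simp_all
  qed
  with l show ?thesis by blast
qed

lemma vertex_in_lat: "special_family m \<Longrightarrow> regular h \<Longrightarrow> m h \<in> lat m"
  unfolding lat_def by (intro CollectI allI impI vertex_order)

lemma exists_dominant_chamber:
  obtains h where "regular h" "\<And>\<beta>. \<beta> \<in> pos h \<Longrightarrow> 0 \<le> x \<bullet> \<beta>"
proof (rule exists_lexicographic_chamber[of x 0])
  fix h assume "regular h" "\<And>\<beta>. \<beta> \<in> pos h \<Longrightarrow> 0 \<le> x \<bullet> \<beta>"
  then show ?thesis by (rule that)
qed

lemma exists_tuple:
  assumes "x \<in> lat sum_family"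
  shows "\<exists>t\<in>tuples. total t = x"
  using assms
proof (induction rule: lat_induct)
  case (outer x)
  obtain h where h: "regular h" "\<And>\<beta>. \<beta> \<in> pos h \<Longrightarrow> 0 \<le> x \<bullet> \<beta>"
    using exists_dominant_chamber[of x] by blast
  show ?case
  proof (cases "x = sum_family h")
    case True
    have "restrict (\<lambda>i. M i h) {1..n} \<in> tuples"
      unfolding tuples_eq by (intro restrict_PiE_iff[THEN iffD2] ballI vertex_in_lat family h(1))
    moreover have "total (restrict (\<lambda>i. M i h) {1..n}) = x" using True by (simp add: sum_family_def total_def)
    ultimately show ?thesis by blast
  next
    case False
    obtain \<gamma> where g: "\<gamma> \<in> pos h" "x + \<gamma> \<in> lat sum_family"
      using exists_maximal_step[OF special_sum_family outer.hyps h False] by metis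
    note gR = pos_root[OF g(1)]
    obtain t where t: "t \<in> tuples" "total t = x + \<gamma>"
      using outer.IH[OF g(2) inner_add_root_greater[OF gR h(2)[OF g(1)]]] by blast
    have "0 < (x + \<gamma>) \<bullet> \<gamma>" using h(2)[OF g(1)] inner_root_pos[OF gR]
      by (simp add: inner_add del: inner_gt_zero_iff)
    then have "0 < total t \<bullet> \<gamma>" using t(2) by simp
    then obtain k where k: "k \<in> {1..n}" "0 < t k \<bullet> \<gamma>" by (rule exists_index)
    have "t(k := t k - \<gamma>) \<in> tuples" using tuple_update tuple_diff_root t(1) k gR by blast
    moreover have "total (t(k := t k - \<gamma>)) = x" using k(1) t(2) by (simp add: total_update)
    ultimately show ?thesis by blast
  qed
qed

text \<open>Lowering by \<open>\<beta> + \<delta>\<close> can be done by \<delta> first and \<beta>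
  second. At an entry pairing positively with the sum, either \<delta> can be removed there as well,
  or \<beta> can, and a root move shifts the removal of \<delta> to another entry.\<close>

lemma down_twice:
  assumes u: "u \<in> tuples" and R: "\<beta> \<in> \<Phi>" "\<delta> \<in> \<Phi>" "\<beta> + \<delta> \<in> \<Phi>"
    and d: "0 < total u \<bullet> \<delta>" and bd: "0 < total u \<bullet> (\<beta> + \<delta>)"
    and l: "l \<in> {1..n}" "u l - (\<beta> + \<delta>) \<in> lat (M l)"
  shows "\<exists>j\<in>{1..n}. \<exists>i\<in>{1..n}. \<exists>v. v = u(j := u j - \<delta>) \<and> v \<in> tuples \<and> v i - \<beta> \<in> lat (M i) \<and>
    v(i := v i - \<beta>) \<sim>\<sim> u(l := u l - (\<beta> + \<delta>))"
proof -
  obtain i where i: "i \<in> {1..n}" "0 < u i \<bullet> (\<beta> + \<delta>)" using exists_index[OF bd] by blast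
  have i': "u i - (\<beta> + \<delta>) \<in> lat (M i)" using tuple_diff_root u i R by blast
  let ?w = "u(i := u i - (\<beta> + \<delta>))"
  have wT: "?w \<in> tuples" using tuple_update u i i' by blast
  have wl: "?w \<sim>\<sim> u(l := u l - (\<beta> + \<delta>))" using down_same u R(3) i(1) l i' by blast
  show ?thesis
  proof (cases "0 < u i \<bullet> \<delta>")
    case True
    then have "u i - \<delta> \<in> lat (M i)" using tuple_diff_root u i R by blast
    then have "u(i := u i - \<delta>) \<in> tuples" using tuple_update u i by blast
    moreover have "(u(i := u i - \<delta>))(i := (u(i := u i - \<delta>)) i - \<beta>) = ?w"
      by (simp add: algebra_simps)
    ultimately show ?thesis using i i' wl
      by (intro bexI[of _ i] exI[of _ "u(i := u i - \<delta>)"]) (auto simp: algebra_simps)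
  next
    case False
    then have ub: "0 < u i \<bullet> \<beta>" using i(2) by (simp add: inner_add)
    then have ib: "u i - \<beta> \<in> lat (M i)" using tuple_diff_root u i R by blast
    obtain j where j: "j \<in> {1..n}" "0 < u j \<bullet> \<delta>" using exists_index[OF d] by blast
    have jd: "u j - \<delta> \<in> lat (M j)" using tuple_diff_root u j R by blast
    have ne: "i \<noteq> j" using j False by blast
    let ?v = "u(j := u j - \<delta>)"
    have vT: "?v \<in> tuples" using tuple_update u j jd by blast
    have "?w \<sim>\<sim> ?w(i := ?w i + \<delta>, j := ?w j - \<delta>)"
      using wT i j ne R ib jd by (intro equivalent_move) (auto simp: algebra_simps)
    also have "?w(i := ?w i + \<delta>, j := ?w j - \<delta>) = ?v(i := ?v i - \<beta>)"
      using ne by (auto simp: algebra_simps)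
    finally have "?v(i := ?v i - \<beta>) \<sim>\<sim> u(l := u l - (\<beta> + \<delta>))"
      using wl equivalent_sym equivalent_trans by blast
    then show ?thesis using i j ne ib vT by (intro bexI[of _ j] bexI[of _ i] exI[of _ ?v]) auto
  qed
qed

subsection \<open>Uniqueness up to root moves\<close>

lemma equivalent_props:
  assumes "t \<sim>\<sim> s" and t: "t \<in> tuples"
  shows "s \<in> tuples \<and> total s = total t"
  using assms(1)[unfolded root_move_equiv_def]
proof (induction rule: equivclp_induct)
  case (step y z)
  then show ?case using root_move_props[of y z] root_move_props[of z y] by auto
qed (use t in simp)

section \<open>The induction step at a dominant sum\<close>

context
  fixes x h
  assumes reg: "regular h" and dom: "\<And>\<beta>. \<beta> \<in> pos h \<Longrightarrow> 0 \<le> x \<bullet> \<beta>"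
    and IH: "\<And>s t. s \<in> tuples \<Longrightarrow> t \<in> tuples \<Longrightarrow> total s = total t \<Longrightarrow>
      x \<bullet> x < total t \<bullet> total t \<Longrightarrow> s \<sim>\<sim> t"
begin

lemma add_root_inner_pos: "\<beta> \<in> pos h \<Longrightarrow> 0 < (x + \<beta>) \<bullet> \<beta>"
  using dom[of \<beta>] inner_root_pos[OF pos_root[of \<beta> h]]
  by (simp add: inner_add del: inner_gt_zero_iff)

lemma equivalent_above:
  assumes "s \<in> tuples" "t \<in> tuples" "total s = x + \<beta>" "total t = x + \<beta>" "\<beta> \<in> pos h"
  shows "s \<sim>\<sim> t"
  using IH[OF assms(1,2)] assms(3,4) inner_add_root_greater[OF pos_root dom, OF assms(5) assms(5)]
  by simp

lemma raise_tuple: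
  assumes "t \<in> tuples" "k \<in> {1..n}" "t k + \<beta> \<in> lat (M k)"
  shows "t(k := t k + \<beta>) \<in> tuples" "total (t(k := t k + \<beta>)) = total t + \<beta>"
  using tuple_update[OF assms] total_update[OF assms(2)] by simp_all

text \<open>The tuple \<open>s\<close> raised by \<beta> lies over a sum of larger norm, where all
  tuples are equivalent. Hence lowering any tuple over \<open>x + \<beta>\<close> leads back to the
  class of \<open>s\<close>.\<close>

lemma lower_above:
  assumes s: "s \<in> tuples" "total s = x" "k \<in> {1..n}" "s k + \<beta> \<in> lat (M k)"
    and v: "v \<in> tuples" "total v = x + \<beta>" "i \<in> {1..n}" "v i - \<beta> \<in> lat (M i)"
    and b: "\<beta> \<in> pos h"
  shows "s \<sim>\<sim> v(i := v i - \<beta>)"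
proof -
  let ?u = "s(k := s k + \<beta>)"
  note u = raise_tuple[OF s(1,3,4)]
  have "?u \<sim>\<sim> v" using equivalent_above[OF u(1) v(1) _ v(2) b] u(2) s(2) by simp
  moreover have "0 < total ?u \<bullet> \<beta>" using u(2) s(2) add_root_inner_pos[OF b] by simp
  ultimately have "?u(k := ?u k - \<beta>) \<sim>\<sim> v(i := v i - \<beta>)"
    using down_equivalent[where t = "?u" and s = v, OF _ u(1) pos_root[OF b] _ s(3) _ v(3,4)] tupleD[OF s(1,3)] by simp
  then show ?thesis by simp
qed

text \<open>Lower the raised \<open>t\<close> in two stages: removing
  \<open>\<gamma> - \<beta>\<close> first lands over \<open>x + \<beta>\<close>, where comparison
  with \<open>s\<close> is possible.\<close>

lemma raised_adjacent_aux:
  assumes s: "s \<in> tuples" "total s = x" "k \<in> {1..n}" "s k + \<beta> \<in> lat (M k)"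
    and t: "t \<in> tuples" "total t = x" "l \<in> {1..n}" "t l + \<gamma> \<in> lat (M l)"
    and b: "\<beta> \<in> pos h" and g: "\<gamma> \<in> pos h" and d: "\<gamma> - \<beta> \<in> \<Phi>" and p: "0 < (x + \<gamma>) \<bullet> (\<gamma> - \<beta>)"
  shows "s \<sim>\<sim> t"
proof -
  let ?w = "t(l := t l + \<gamma>)"
  note w = raise_tuple[OF t(1,3,4)]
  have sum: "\<beta> + (\<gamma> - \<beta>) = \<gamma>" by simp
  have tw: "total ?w = x + \<gamma>" using w(2) t(2) by simp
  have "\<exists>j\<in>{1..n}. \<exists>i\<in>{1..n}. \<exists>v. v = ?w(j := ?w j - (\<gamma> - \<beta>)) \<and> v \<in> tuples \<and>
      v i - \<beta> \<in> lat (M i) \<and> v(i := v i - \<beta>) \<sim>\<sim> ?w(l := ?w l - (\<beta> + (\<gamma> - \<beta>)))"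
    using pos_root[OF b] pos_root[OF g] d p tw w(1) t(3) tupleD[OF t(1,3)] add_root_inner_pos[OF g]
    by (intro down_twice) simp_all
  then obtain j i v where j: "j \<in> {1..n}" and i: "i \<in> {1..n}"
    and v: "v = ?w(j := ?w j - (\<gamma> - \<beta>))" "v \<in> tuples" "v i - \<beta> \<in> lat (M i)"
      "v(i := v i - \<beta>) \<sim>\<sim> ?w(l := ?w l - (\<beta> + (\<gamma> - \<beta>)))"
    by blast
  have "total v = x + \<beta>" unfolding v(1) total_update[OF j] tw by simp
  from lower_above[OF s v(2) this i v(3) b] have "s \<sim>\<sim> v(i := v i - \<beta>)" .
  also note v(4)
  also have "?w(l := ?w l - (\<beta> + (\<gamma> - \<beta>))) = t" by simp
  finally show ?thesis .
qed

text \<open>The pairings required by the two orientations of the previous argument add up to the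
  squared length of \<open>\<gamma> - \<beta>\<close>, so one of them is positive.\<close>

lemma raised_adjacent:
  assumes s: "s \<in> tuples" "total s = x" "k \<in> {1..n}" "s k + \<beta> \<in> lat (M k)"
    and t: "t \<in> tuples" "total t = x" "l \<in> {1..n}" "t l + \<gamma> \<in> lat (M l)"
    and b: "\<beta> \<in> pos h" and g: "\<gamma> \<in> pos h" and d: "\<gamma> = \<beta> \<or> \<gamma> - \<beta> \<in> \<Phi>"
  shows "s \<sim>\<sim> t"
proof (cases "\<gamma> = \<beta>")
  case True
  note w = raise_tuple[OF t(1,3,4)]
  have "s \<sim>\<sim> (t(l := t l + \<gamma>))(l := (t(l := t l + \<gamma>)) l - \<beta>)"
    using lower_above[OF s w(1) _ t(3) _ b] w(2) t(2) tupleD[OF t(1,3)] True by simp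
  then show ?thesis using True by simp
next
  case False
  with d have d: "\<gamma> - \<beta> \<in> \<Phi>" by blast
  then have d': "\<beta> - \<gamma> \<in> \<Phi>" using uminus_root by force
  have "(x + \<gamma>) \<bullet> (\<gamma> - \<beta>) + (x + \<beta>) \<bullet> (\<beta> - \<gamma>) = (\<gamma> - \<beta>) \<bullet> (\<gamma> - \<beta>)"
    by (simp add: inner_add inner_diff inner_commute algebra_simps)
  then have "0 < (x + \<gamma>) \<bullet> (\<gamma> - \<beta>) \<or> 0 < (x + \<beta>) \<bullet> (\<beta> - \<gamma>)"
    using inner_root_pos[OF d] by argo
  then show ?thesis
    using raised_adjacent_aux[OF s t b g d] raised_adjacent_aux[OF t s g b d'] equivalent_sym by blast
qed

definition raises :: "(nat \<Rightarrow> 'a) \<Rightarrow> 'a set" where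
  "raises t = {\<beta>\<in>pos h. \<exists>s k. t \<sim>\<sim> s \<and> k \<in> {1..n} \<and> s k + \<beta> \<in> lat (M k)}"

lemma raisesE:
  assumes "\<beta> \<in> raises t" "t \<in> tuples" "total t = x"
  obtains s k where "t \<sim>\<sim> s" "s \<in> tuples" "total s = x" "k \<in> {1..n}" "s k + \<beta> \<in> lat (M k)" "\<beta> \<in> pos h"
  using assms equivalent_props[OF _ assms(2)] by (auto simp: raises_def)

text \<open>Existence over \<open>x + \<gamma>\<close> supplies a tuple to be lowered by \<gamma>,
  and the result lies in the class of \<open>t\<close>. This is how maximality within
  \<open>raises t\<close> becomes maximality among lattice points.\<close>

lemma raises_adjacent:
  assumes t: "t \<in> tuples" "total t = x" and b: "\<beta> \<in> raises t" and g: "\<gamma> \<in> pos h"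
    and xg: "x + \<gamma> \<in> lat sum_family" and d: "\<gamma> - \<beta> \<in> \<Phi>"
  shows "\<gamma> \<in> raises t"
proof -
  obtain s k where s: "t \<sim>\<sim> s" "s \<in> tuples" "total s = x" "k \<in> {1..n}" "s k + \<beta> \<in> lat (M k)"
    and bp: "\<beta> \<in> pos h" by (rule raisesE[OF b t])
  obtain u where u: "u \<in> tuples" "total u = x + \<gamma>" using exists_tuple[OF xg] by blast
  have "0 < total u \<bullet> \<gamma>" using u(2) add_root_inner_pos[OF g] by simp
  then obtain l where l: "l \<in> {1..n}" "0 < u l \<bullet> \<gamma>" by (rule exists_index)
  let ?v = "u(l := u l - \<gamma>)"
  have v: "?v \<in> tuples" using tuple_update tuple_diff_root u(1) l pos_root[OF g] by blast
  have tv: "total ?v = x" using l(1) u(2) by (simp add: total_update)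
  have "?v l + \<gamma> \<in> lat (M l)" using tupleD[OF u(1) l(1)] by simp
  from raised_adjacent[OF s(2-5) v tv l(1) this bp g] d have "s \<sim>\<sim> ?v" by blast
  with s(1) have "t \<sim>\<sim> ?v" by (rule equivalent_trans)
  with \<open>?v l + \<gamma> \<in> lat (M l)\<close> l(1) g show ?thesis unfolding raises_def by blast
qed

text \<open>Lower a tuple over \<open>x + \<gamma> + \<delta>\<close> by \<delta> and then by
  \<gamma>, reaching the class of \<open>t\<close>, and put \<delta> back. If both removals hit the
  same entry, \<open>0 \<le> \<gamma> \<bullet> \<delta>\<close> ensures that \<gamma> alone can be
  removed from it.\<close>

lemma raises_commuting:
  assumes t: "t \<in> tuples" "total t = x" and gr: "\<gamma> \<in> raises t" and d: "\<delta> \<in> pos h"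
    and xgd: "x + \<gamma> + \<delta> \<in> lat sum_family" and xd: "0 \<le> (x + \<gamma>) \<bullet> \<delta>" and gd: "0 \<le> \<gamma> \<bullet> \<delta>"
  shows "\<delta> \<in> raises t"
proof -
  obtain s k where s: "t \<sim>\<sim> s" "s \<in> tuples" "total s = x" "k \<in> {1..n}" "s k + \<gamma> \<in> lat (M k)"
    and g: "\<gamma> \<in> pos h" by (rule raisesE[OF gr t])
  note gR = pos_root[OF g] and dR = pos_root[OF d]
  obtain z where z: "z \<in> tuples" "total z = x + \<gamma> + \<delta>" using exists_tuple[OF xgd] by blast
  have "0 < total z \<bullet> \<delta>" using z(2) xd inner_root_pos[OF dR]
    by (simp add: inner_add del: inner_gt_zero_iff)
  then obtain j where j: "j \<in> {1..n}" "0 < z j \<bullet> \<delta>" by (rule exists_index)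
  define u where "u = z(j := z j - \<delta>)"
  have u: "u \<in> tuples" "total u = x + \<gamma>" unfolding u_def
    using tuple_update tuple_diff_root z(1) j dR total_update[OF j(1)] z(2) by auto
  have "0 < total u \<bullet> \<gamma>" using u(2) add_root_inner_pos[OF g] by simp
  then obtain i where i: "i \<in> {1..n}" "0 < u i \<bullet> \<gamma>" by (rule exists_index)
  let ?w = "u(i := u i - \<gamma>)"
  have "s \<sim>\<sim> ?w" using lower_above[OF s(2-5) u i(1) tuple_diff_root[OF u(1) i(1) gR i(2)] g] .
  with s(1) have tw: "t \<sim>\<sim> ?w" by (rule equivalent_trans)
  have "?w j + \<delta> \<in> lat (M j)"
  proof (cases "i = j")
    case True
    have "0 < z j \<bullet> \<gamma>" using i(2) True gd by (simp add: u_def inner_diff inner_commute)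
    from tuple_diff_root[OF z(1) j(1) gR this] show ?thesis using True by (simp add: u_def algebra_simps)
  next
    case False
    then show ?thesis using tupleD[OF z(1) j(1)] by (simp add: u_def)
  qed
  with tw j(1) d show ?thesis unfolding raises_def by blast
qed

lemma raises_nonempty:
  assumes t: "t \<in> tuples" "total t = x" and ne: "x \<noteq> sum_family h"
  shows "raises t \<noteq> {}"
proof -
  have "\<exists>k\<in>{1..n}. t k \<noteq> M k h"
  proof (rule ccontr)
    assume "\<not> ?thesis"
    then have "total t = sum_family h" unfolding total_def sum_family_def by (intro sum.cong) auto
    with ne t(2) show False by simp
  qed
  then obtain k where k: "k \<in> {1..n}" "t k \<noteq> M k h" by blast
  note tk = tupleD[OF t(1) k(1)]
  have "\<exists>\<beta>\<in>pos h. t k + \<beta> \<in> lat (M k)"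
  proof (cases "\<forall>\<beta>\<in>pos h. 0 \<le> t k \<bullet> \<beta>")
    case True
    then show ?thesis using exists_maximal_step[OF family[OF k(1)] tk reg _ k(2)] by metis
  next
    case False
    then obtain \<beta> where "\<beta> \<in> pos h" "t k \<bullet> \<beta> < 0" by force
    then show ?thesis using lat_add_root[OF family[OF k(1)] tk pos_root] by blast
  qed
  then show ?thesis using k(1) equivalent_refl unfolding raises_def by blast
qed

text \<open>Only the first step depends on \<open>t\<close>. The highest \<gamma> in
  \<open>raises t\<close> admits no larger root \<open>\<gamma> + \<delta>\<close> addable to
  \<open>x\<close>, so \<open>x + \<gamma>\<close> is dominant, and every positive root that can be
  added there is in \<open>raises t\<close> by commutation. From \<open>x + \<gamma>\<close> on, the
  statement about lattice points takes over.\<close>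

lemma inner_vertex_nonpos:
  assumes t: "t \<in> tuples" "total t = x" and w: "\<And>\<beta>. \<beta> \<in> raises t \<Longrightarrow> w \<bullet> \<beta> \<le> 0"
  shows "w \<bullet> (sum_family h - x) \<le> 0"
proof (cases "x = sum_family h")
  case False
  note ne = raises_nonempty[OF t False]
  have fin: "finite (raises t)" using finite_pos by (simp add: raises_def)
  define \<gamma> where "\<gamma> = arg_min_on (\<lambda>\<delta>. - (\<delta> \<bullet> h)) (raises t)"
  have g: "\<gamma> \<in> raises t" unfolding \<gamma>_def using fin ne by (rule arg_min_if_finite(1))
  have max: "\<delta> \<bullet> h \<le> \<gamma> \<bullet> h" if "\<delta> \<in> raises t" for \<delta>
    using arg_min_least[OF fin ne that, of "\<lambda>\<delta>. - (\<delta> \<bullet> h)"] by (simp add: \<gamma>_def)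
  obtain s k where s: "s \<in> tuples" "total s = x" "k \<in> {1..n}" "s k + \<gamma> \<in> lat (M k)"
    and gp: "\<gamma> \<in> pos h" by (rule raisesE[OF g t])
  note gR = pos_root[OF gp]
  have xg: "x + \<gamma> \<in> lat sum_family"
    using total_lat[OF raise_tuple(1)[OF s(1,3,4)]] raise_tuple(2)[OF s(1,3,4)] s(2) by simp
  have maxl: "x + (\<gamma> + \<delta>) \<notin> lat sum_family" if d: "\<delta> \<in> pos h" "\<gamma> + \<delta> \<in> \<Phi>" for \<delta>
  proof
    assume "x + (\<gamma> + \<delta>) \<in> lat sum_family"
    then have "\<gamma> + \<delta> \<in> raises t"
      using raises_adjacent[OF t g pos_add[OF gp d]] pos_root[OF d(1)] by simp
    from max[OF this] pos_inner[OF d(1)] show False by (simp add: inner_add)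
  qed
  have sumroot: "\<gamma> + \<delta> \<in> \<Phi>" if "\<delta> \<in> pos h" "\<gamma> \<bullet> \<delta> < 0" for \<delta>
    using sum_root[OF gR pos_root[OF that(1)] that(2)] gp uminus_pos[OF that(1)] by blast
  have dom': "0 \<le> (x + \<gamma>) \<bullet> \<alpha>" if a: "\<alpha> \<in> pos h" for \<alpha>
  proof (rule ccontr)
    assume "\<not> ?thesis"
    then have neg: "(x + \<gamma>) \<bullet> \<alpha> < 0" by simp
    then have "\<gamma> \<bullet> \<alpha> < 0" using dom[OF a] by (simp add: inner_add)
    then have "x + (\<gamma> + \<alpha>) \<notin> lat sum_family" using sumroot maxl a by blast
    moreover have "x + \<gamma> + \<alpha> \<in> lat sum_family"
      using lat_add_root[OF special_sum_family xg pos_root[OF a] neg] .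
    ultimately show False by (simp add: add.assoc)
  qed
  have "w \<bullet> (sum_family h - (x + \<gamma>)) \<le> 0"
  proof (rule inner_difference_nonpos[OF special_sum_family xg reg dom'])
    fix \<delta> assume d: "\<delta> \<in> pos h" "x + \<gamma> + \<delta> \<in> lat sum_family"
    have "0 \<le> \<gamma> \<bullet> \<delta>" using sumroot[OF d(1)] maxl[OF d(1)] d(2) by (force simp: add.assoc)
    from raises_commuting[OF t g d dom'[OF d(1)] this] show "w \<bullet> \<delta> \<le> 0" by (rule w)
  qed
  moreover have "w \<bullet> \<gamma> \<le> 0" by (rule w[OF g])
  ultimately show ?thesis by (simp add: inner_diff inner_add)
qed simp

lemma equivalent_at:
  assumes s: "s \<in> tuples" "total s = x" and t: "t \<in> tuples" "total t = x"
  shows "s \<sim>\<sim> t"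
proof (rule ccontr)
  assume ne: "\<not> s \<sim>\<sim> t"
  let ?u = "sum_family h - x"
  have "\<gamma> \<bullet> \<beta> \<le> 0" if b: "\<beta> \<in> raises s" and g: "\<gamma> \<in> raises t" for \<beta> \<gamma>
  proof (rule ccontr)
    assume "\<not> \<gamma> \<bullet> \<beta> \<le> 0"
    then have gb: "0 < \<gamma> \<bullet> \<beta>" by simp
    obtain s' k where s': "s \<sim>\<sim> s'" "s' \<in> tuples" "total s' = x" "k \<in> {1..n}" "s' k + \<beta> \<in> lat (M k)"
      and bp: "\<beta> \<in> pos h" by (rule raisesE[OF b s])
    obtain t' l where t': "t \<sim>\<sim> t'" "t' \<in> tuples" "total t' = x" "l \<in> {1..n}" "t' l + \<gamma> \<in> lat (M l)"
      and gp: "\<gamma> \<in> pos h" by (rule raisesE[OF g t])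
    have "\<gamma> = \<beta> \<or> \<gamma> - \<beta> \<in> \<Phi>" using diff_root[OF pos_root[OF gp] pos_root[OF bp] gb] by blast
    from raised_adjacent[OF s'(2-5) t'(2-5) bp gp this] have "s' \<sim>\<sim> t'" .
    with s'(1) t'(1) ne show False using equivalent_trans equivalent_sym by blast
  qed
  \<comment> \<open>The dual cone statement is used twice: with a root of \<open>raises t\<close>
    against the class of \<open>s\<close>, then with \<open>?u\<close> itself against the class of
    \<open>t\<close>.\<close>
  then have "\<gamma> \<bullet> ?u \<le> 0" if "\<gamma> \<in> raises t" for \<gamma>
    using inner_vertex_nonpos[OF s] that by blast
  then have "?u \<bullet> ?u \<le> 0" using inner_vertex_nonpos[OF t, of ?u] by (simp add: inner_commute)
  then have u0: "?u = 0" by (metis inner_gt_zero_iff not_less)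
  have entries: "r k = M k h" if r: "r \<in> tuples" "total r = x" and k: "k \<in> {1..n}" for r k
  proof -
    have "(\<Sum>i=1..n. M i h - r i) = 0"
      using u0 r(2) by (simp add: total_def sum_family_def sum_subtractf)
    from Qp_zero_sum[OF reg _ this latD[OF tupleD[OF r(1)] reg] k] show ?thesis by simp
  qed
  have "s = t"
    by (rule PiE_ext[OF s(1)[unfolded tuples_eq] t(1)[unfolded tuples_eq]])
      (simp only: entries[OF s] entries[OF t])
  with ne equivalent_refl show False by simp
qed

end

theorem equivalent_if_total_eq:
  assumes "s \<in> tuples" "t \<in> tuples" "total s = total t"
  shows "s \<sim>\<sim> t"
proof -
  have "\<forall>s\<in>tuples. \<forall>t\<in>tuples. total s = x \<longrightarrow> total t = x \<longrightarrow> s \<sim>\<sim> t" if "x \<in> lat sum_family" for x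
    using that
  proof (induction rule: lat_induct)
    case (outer x)
    show ?case
    proof (rule exists_dominant_chamber[of x], intro ballI impI)
      fix h s t
      assume h: "regular h" "\<And>\<beta>. \<beta> \<in> pos h \<Longrightarrow> 0 \<le> x \<bullet> \<beta>"
        and st: "s \<in> tuples" "t \<in> tuples" "total s = x" "total t = x"
      have "a \<sim>\<sim> b" if "a \<in> tuples" "b \<in> tuples" "total a = total b"
        "x \<bullet> x < total b \<bullet> total b" for a b
        using outer.IH[OF total_lat[OF that(2)] that(4)] that by blast
      from equivalent_at[OF h this st(1,3,2,4)] show "s \<sim>\<sim> t" by blast
    qed
  qed
  with assms total_lat[OF assms(2)] show ?thesis by blast
qed

end

subsection \<open>Chambers and polytopes\<close>

text \<open>A segment through one summand, translated by the others, would be a segment through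
  \<open>v\<close>. This identifies the coset of the root lattice in which the lattice points of a
  Minkowski sum lie.\<close>

lemma extreme_point_of_set_sum:
  fixes P :: "'i \<Rightarrow> 'a::euclidean_space set"
  assumes fin: "finite I" and v: "v extreme_point_of (\<Sum>i\<in>I. P i)"
  obtains s where "v = (\<Sum>i\<in>I. s i)" "\<And>i. i \<in> I \<Longrightarrow> s i extreme_point_of P i"
proof -
  have alt: "(\<Sum>i\<in>I. P i) = {sum s I |s. \<forall>i\<in>I. s i \<in> P i}" by (rule set_sum_alt[OF fin])
  have "v \<in> (\<Sum>i\<in>I. P i)" using v by (simp add: extreme_point_of_def)
  then obtain s where s: "v = sum s I" "\<And>i. i \<in> I \<Longrightarrow> s i \<in> P i" unfolding alt by blast
  have "s i extreme_point_of P i" if i: "i \<in> I" for i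
    unfolding extreme_point_of_def
  proof (intro conjI ballI notI)
    show "s i \<in> P i" using s i by blast
    fix a b assume ab: "a \<in> P i" "b \<in> P i" "s i \<in> open_segment a b"
    define r where "r = sum s (I - {i})"
    have mem: "c + r \<in> (\<Sum>i\<in>I. P i)" if c: "c \<in> P i" for c
    proof -
      have "c + r = sum (s(i := c)) I"
        using sum.remove[OF fin i, of "s(i := c)"] by (simp add: r_def)
      moreover have "\<forall>j\<in>I. (s(i := c)) j \<in> P j" using s(2) c by simp
      ultimately show ?thesis unfolding alt by blast
    qed
    have vr: "v = s i + r" unfolding r_def s(1) by (rule sum.remove[OF fin i])
    obtain u where u: "a \<noteq> b" "0 < u" "u < 1" "s i = (1 - u) *\<^sub>R a + u *\<^sub>R b"
      using ab(3) by (auto simp: in_segment)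
    have "v = (1 - u) *\<^sub>R (a + r) + u *\<^sub>R (b + r)"
      unfolding vr u(4) by (simp add: algebra_simps)
    then have "v \<in> open_segment (a + r) (b + r)" using u by (auto simp: in_segment)
    with v mem ab(1,2) show False by (simp add: extreme_point_of_def)
  qed
  with s(1) that show ?thesis by blast
qed

context root_sys
begin

section \<open>Chambers as open cones and their walls\<close>

definition chamber :: "'a \<Rightarrow> 'a set" where "chamber h = {v. \<forall>\<alpha>\<in>pos h. 0 < \<alpha> \<bullet> v}"

lemma mem_chamber: "h \<in> chamber h"
  by (simp add: chamber_def pos_inner)

lemma convex_chamber: "convex (chamber h)"
proof -
  have "chamber h = (\<Inter>\<alpha>\<in>pos h. {v. \<alpha> \<bullet> v > 0})" by (auto simp: chamber_def)
  then show ?thesis by (simp add: convex_INT convex_halfspace_gt)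
qed

lemma chamber_regular: assumes "regular h" "v \<in> chamber h" shows "regular v"
  unfolding regular_def
proof
  fix \<alpha> assume "\<alpha> \<in> \<Phi>"
  from pos_or_neg[OF assms(1) this] assms(2) show "\<alpha> \<bullet> v \<noteq> 0" by (force simp: chamber_def)
qed

text \<open>The cone is convex, hence connected, and a connected set leaving it must meet a root
  hyperplane, so it contains a vector that is not regular.\<close>

lemma weyl_chambers_eq: "weyl_chambers \<Phi> = chamber ` {h. regular h}"
proof -
  let ?S = "{h. regular h}"
  have "connected_component_set ?S h = chamber h" if reg: "regular h" for h
  proof
    show "chamber h \<subseteq> connected_component_set ?S h"
      using mem_chamber convex_connected[OF convex_chamber] chamber_regular[OF reg]
      by (intro connected_component_maximal) auto
    show "connected_component_set ?S h \<subseteq> chamber h"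
    proof
      fix v assume v: "v \<in> connected_component_set ?S h"
      have h: "h \<in> connected_component_set ?S h" using reg by simp
      show "v \<in> chamber h" unfolding chamber_def
      proof (intro CollectI ballI, rule ccontr)
        fix \<alpha> assume a: "\<alpha> \<in> pos h" "\<not> 0 < \<alpha> \<bullet> v"
        then obtain z where "z \<in> connected_component_set ?S h" "\<alpha> \<bullet> z = 0"
          using connected_ivt_hyperplane[OF connected_connected_component v h, of \<alpha> 0] pos_inner[OF a(1)]
          by auto
        then show False using connected_component_subset[of ?S h] pos_root[OF a(1)]
          by (auto simp: regular_def)
      qed
    qed
  qed
  moreover have "{h. \<forall>\<alpha>\<in>\<Phi>. \<alpha> \<bullet> h \<noteq> 0} = ?S" by (simp add: regular_def)
  ultimately show ?thesis unfolding weyl_chambers_def components_def by auto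
qed

lemma positive_roots_chamber: "positive_roots \<Phi> (chamber h) = pos h"
  using mem_chamber by (force simp: positive_roots_def chamber_def pos_def)

lemma simple_roots_chamber: "simple_roots \<Phi> (chamber h) = simple h"
  by (simp add: simple_roots_def simple_def positive_roots_chamber)

lemma mem_closure_chamber:
  assumes "\<And>\<beta>. \<beta> \<in> pos h \<Longrightarrow> 0 \<le> \<beta> \<bullet> v"
  shows "v \<in> closure (chamber h)"
  unfolding closure_approachable
proof (intro allI impI)
  fix e :: real assume e: "0 < e"
  define d where "d = e / (norm h + 1)"
  have d: "0 < d" using e by (simp add: d_def add_nonneg_pos)
  have "d * norm h < d * (norm h + 1)" using d by simp
  also have "\<dots> = e" using norm_ge_zero[of h] by (simp add: d_def add_nonneg_eq_0_iff)
  finally have "dist (v + d *\<^sub>R h) v < e" using d by (simp add: dist_norm)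
  moreover have "v + d *\<^sub>R h \<in> chamber h"
    using assms d pos_inner by (auto simp: chamber_def inner_add intro!: add_nonneg_pos)
  ultimately show "\<exists>y\<in>chamber h. dist y v < e" by blast
qed

context
  fixes h \<alpha> assumes reg: "regular h" and a: "\<alpha> \<in> simple h"
begin

lemma uminus_simple_pos: "- \<alpha> \<in> pos (root_reflection \<alpha> h)"
  using pos_simple_reflection[OF reg a] by simp

lemma pos_simple_reflectionI: "\<beta> \<in> pos h \<Longrightarrow> \<beta> \<noteq> \<alpha> \<Longrightarrow> \<beta> \<in> pos (root_reflection \<alpha> h)"
  using pos_simple_reflection[OF reg a] by simp

text \<open>The vector \<open>h + root_reflection \<alpha> h\<close> lies on the wall of \<alpha>
  and is positive on all other positive roots. So the common face contains a nonempty relatively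
  open piece of that hyperplane.\<close>

lemma adjacent_chambers_reflection:
  "adjacent_chambers \<Phi> (chamber h) (chamber (root_reflection \<alpha> h))"
proof -
  let ?g = "root_reflection \<alpha> h"
  note aR = simple_root[OF a] and aP = simple_pos[OF a]
  have regg: "regular ?g" by (rule regular_reflection[OF aR reg])
  let ?H = "{v. \<alpha> \<bullet> v = 0}"
  let ?T = "\<Inter>\<beta>\<in>pos h - {\<alpha>}. {v. \<beta> \<bullet> v > 0}"
  let ?I = "closure (chamber h) \<inter> closure (chamber ?g)"
  have hyp: "aff_dim ?H = int DIM('a) - 1" 
    using aff_dim_hyperplane[OF root_nonzero[OF aR], of 0] by (simp add: of_nat_diff)
  have "closure (chamber h) \<subseteq> {v. \<alpha> \<bullet> v \<ge> 0}"
    by (intro closure_minimal closed_halfspace_ge) (use aP in \<open>auto simp: chamber_def less_imp_le\<close>)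
  moreover have "closure (chamber ?g) \<subseteq> {v. \<alpha> \<bullet> v \<le> 0}"
    by (intro closure_minimal closed_halfspace_le)
      (use uminus_simple_pos in \<open>force simp: chamber_def\<close>)
  ultimately have "?I \<subseteq> ?H" by force
  then have le: "aff_dim ?I \<le> int DIM('a) - 1" using aff_dim_subset hyp by metis
  have "h + ?g \<in> ?T"
    using pos_inner pos_simple_reflectionI by (auto simp: inner_add intro!: add_pos_pos)
  moreover have "h + ?g \<in> ?H"
    using root_reflection_self_adjoint[of \<alpha> h \<alpha>] root_reflection_self[OF aR]
    by (simp add: inner_add inner_commute)
  ultimately have "?H \<inter> ?T \<noteq> {}" by blast
  moreover have "open ?T" using finite_pos by (intro open_INT) (auto intro: open_halfspace_gt)
  ultimately have "aff_dim (?H \<inter> ?T) = aff_dim ?H"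
    by (intro aff_dim_convex_Int_open convex_hyperplane)
  moreover have "?H \<inter> ?T \<subseteq> ?I"
  proof
    fix v assume v: "v \<in> ?H \<inter> ?T"
    have "0 \<le> \<beta> \<bullet> v" if "\<beta> \<in> pos h" for \<beta> using v that by (cases "\<beta> = \<alpha>") (auto simp: less_imp_le)
    moreover have "0 \<le> \<beta> \<bullet> v" if "\<beta> \<in> pos ?g" for \<beta>
      using v that pos_simple_reflection[OF reg a] by (cases "\<beta> = - \<alpha>") (auto simp: less_imp_le)
    ultimately show "v \<in> ?I" using mem_closure_chamber by blast
  qed
  ultimately have "aff_dim ?I \<ge> int DIM('a) - 1" using aff_dim_subset hyp by metis
  with le have "aff_dim ?I = int DIM('a) - 1" by simp
  moreover have "chamber h \<noteq> chamber ?g"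
  proof
    assume "chamber h = chamber ?g"
    then have "h \<in> chamber ?g" using mem_chamber[of h] by simp
    then have "0 < - \<alpha> \<bullet> h" using uminus_simple_pos unfolding chamber_def by blast
    with pos_inner[OF aP] show False by simp
  qed
  ultimately show ?thesis
    unfolding adjacent_chambers_def using weyl_chambers_eq reg regg by blast
qed

lemma separating_root_reflection:
  "separating_root \<Phi> (chamber h) (chamber (root_reflection \<alpha> h)) = \<alpha>"
  unfolding separating_root_def
proof (rule the_equality)
  note aP = simple_pos[OF a]
  show "\<alpha> \<in> \<Phi> \<and> (\<forall>h\<in>chamber h. 0 < \<alpha> \<bullet> h) \<and> (\<forall>h\<in>chamber (root_reflection \<alpha> h). \<alpha> \<bullet> h < 0)"
    using pos_root[OF aP] aP uminus_simple_pos by (force simp: chamber_def)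
  fix \<gamma> assume g: "\<gamma> \<in> \<Phi> \<and> (\<forall>h\<in>chamber h. 0 < \<gamma> \<bullet> h) \<and> (\<forall>h\<in>chamber (root_reflection \<alpha> h). \<gamma> \<bullet> h < 0)"
  then have "\<gamma> \<in> pos h" using mem_chamber by (simp add: pos_def)
  moreover have "\<gamma> \<bullet> root_reflection \<alpha> h < 0" using g mem_chamber by blast
  then have "\<gamma> \<notin> pos (root_reflection \<alpha> h)" by (simp add: pos_def)
  ultimately show "\<gamma> = \<alpha>" using pos_simple_reflectionI by blast
qed

end

section \<open>Lattice points of a special ample polytope\<close>

context
  fixes \<mu> P
  assumes ample: "ample_polytope_with \<Phi> \<mu> P"
    and dominant: "\<forall>\<sigma>\<in>weyl_chambers \<Phi>. chamber_dominant \<Phi> \<sigma> (\<mu> \<sigma>)"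
begin

lemma chamber_in: "regular h \<Longrightarrow> chamber h \<in> weyl_chambers \<Phi>"
  using weyl_chambers_eq by blast

lemma special_family_polytope: "special_family (\<lambda>h. \<mu> (chamber h))"
  unfolding special_family_def
proof (intro allI impI conjI ballI)
  fix h assume reg: "regular h"
  show "\<mu> (chamber h) \<bullet> coroot \<beta> \<in> \<int>" if "\<beta> \<in> \<Phi>" for \<beta>
    using ample chamber_in[OF reg] that by (auto simp: ample_polytope_with_def weight_lattice_def)
  show "0 \<le> \<mu> (chamber h) \<bullet> \<beta>" if "\<beta> \<in> pos h" for \<beta>
    using dominant chamber_in[OF reg] that simple_root inner_coroot_nonneg_iff
    by (intro dominant_if_simple[OF _ that]) (auto simp: chamber_dominant_def simple_roots_chamber)
  show "\<mu> (chamber h') = \<mu> (chamber h)" if "pos h' = pos h" for h'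
    using that by (simp add: chamber_def)
  show "\<exists>r::int. 0 \<le> r \<and> \<mu> (chamber h) - \<mu> (chamber (root_reflection \<alpha> h)) = of_int r *\<^sub>R \<alpha>"
    if a: "\<alpha> \<in> simple h" for \<alpha>
  proof -
    obtain r :: int where "0 < r" "\<mu> (chamber h) - \<mu> (chamber (root_reflection \<alpha> h)) = of_int r *\<^sub>R \<alpha>"
      using ample adjacent_chambers_reflection[OF reg a] separating_root_reflection[OF reg a]
      unfolding ample_polytope_with_def by metis
    then show ?thesis by (intro exI[of _ r]) simp
  qed
qed

lemma extreme_point_iff: "v extreme_point_of P \<longleftrightarrow> (\<exists>h. regular h \<and> v = \<mu> (chamber h))"
  using ample weyl_chambers_eq by (auto simp: ample_polytope_with_def)

text \<open>The condition is convex in \<open>x\<close> and holds at the vertices by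
  \<open>vertex_order\<close>, hence on their convex hull.\<close>

lemma polytope_coef_nonneg:
  assumes reg: "regular h" and x: "x \<in> P" and a: "\<alpha> \<in> simple h"
  shows "0 \<le> coef h (\<mu> (chamber h) - x) \<alpha>"
proof -
  let ?C = "{x. 0 \<le> coef h (\<mu> (chamber h) - x) \<alpha>}"
  have P: "polytope P" using ample by (simp add: ample_polytope_with_def)
  have "P = convex hull {v. v extreme_point_of P}"
    by (rule Krein_Milman_Minkowski[OF polytope_imp_compact[OF P] polytope_imp_convex[OF P]])
  also have "\<dots> \<subseteq> ?C"
  proof (rule hull_minimal)
    show "{v. v extreme_point_of P} \<subseteq> ?C"
      using vertex_order[OF special_family_polytope _ reg] a by (auto simp: extreme_point_iff Qp_def)
    show "convex ?C"
      unfolding convex_def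
    proof (intro ballI allI impI CollectI)
      fix y z and u v :: real
      assume yz: "y \<in> ?C" "z \<in> ?C" and uv: "0 \<le> u" "0 \<le> v" "u + v = 1"
      have "\<mu> (chamber h) = u *\<^sub>R \<mu> (chamber h) + v *\<^sub>R \<mu> (chamber h)"
        using uv(3) by (metis scaleR_left_distrib scaleR_one)
      then have "\<mu> (chamber h) - (u *\<^sub>R y + v *\<^sub>R z) = u *\<^sub>R (\<mu> (chamber h) - y) + v *\<^sub>R (\<mu> (chamber h) - z)"
        by (simp add: algebra_simps)
      then have "coef h (\<mu> (chamber h) - (u *\<^sub>R y + v *\<^sub>R z)) \<alpha> =
          u * coef h (\<mu> (chamber h) - y) \<alpha> + v * coef h (\<mu> (chamber h) - z) \<alpha>"
        by (simp only: coef_add[OF reg] coef_scale[OF reg])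
      with yz uv show "0 \<le> coef h (\<mu> (chamber h) - (u *\<^sub>R y + v *\<^sub>R z)) \<alpha>" by simp
    qed
  qed
  finally show ?thesis using x by blast
qed

text \<open>For the inclusion of \<open>lat\<close> in the polytope, separate an outside point by a
  hyperplane with normal \<open>a\<close> and take a chamber on which \<open>- a\<close> is
  dominant: the vertex there has \<open>- a\<close>-value at least that of the point, against the
  separation.\<close>

lemma lattice_points_polytope: "lattice_points \<Phi> P = lat (\<lambda>h. \<mu> (chamber h))"
proof (intro equalityI subsetI)
  fix x assume "x \<in> lattice_points \<Phi> P"
  then obtain g where x: "x \<in> P" and g: "regular g" "x - \<mu> (chamber g) \<in> Y"
    using extreme_point_iff by (auto simp: lattice_points_def Y_def)
  show "x \<in> lat (\<lambda>h. \<mu> (chamber h))"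
    unfolding lat_def
  proof (intro CollectI allI impI)
    fix h assume reg: "regular h"
    have "(\<mu> (chamber h) - \<mu> (chamber g)) - (x - \<mu> (chamber g)) \<in> Y"
      using vertex_order[OF special_family_polytope g(1) reg] g(2) Y_diff Qp_in_Y by blast
    then show "\<mu> (chamber h) - x \<in> Qp h"
      using polytope_coef_nonneg[OF reg x] by (simp add: Qp_def)
  qed
next
  fix x assume x: "x \<in> lat (\<lambda>h. \<mu> (chamber h))"
  have P: "polytope P" using ample by (simp add: ample_polytope_with_def)
  have "x \<in> P"
  proof (rule ccontr)
    assume "x \<notin> P"
    then obtain a b where ab: "a \<bullet> x < b" "\<And>y. y \<in> P \<Longrightarrow> b < a \<bullet> y"
      using separating_hyperplane_closed_point[OF polytope_imp_convex[OF P] polytope_imp_closed[OF P]]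
      by blast
    obtain h where h: "regular h" "\<And>\<beta>. \<beta> \<in> pos h \<Longrightarrow> 0 \<le> - a \<bullet> \<beta>"
      using exists_lexicographic_chamber[of "- a" 0] by metis
    have "\<mu> (chamber h) \<in> P"
      using extreme_point_iff h(1) unfolding extreme_point_of_def by blast
    then have "b < a \<bullet> \<mu> (chamber h)" by (rule ab(2))
    moreover have "0 \<le> - a \<bullet> (\<mu> (chamber h) - x)"
      by (rule Qp_inner_nonneg[OF h(1) latD[OF x h(1)] h(2)])
    ultimately show False using ab(1) by (simp add: inner_diff)
  qed
  moreover obtain h where reg: "regular h" using exists_regular by blast
  have "- (\<mu> (chamber h) - x) \<in> Y" using Y_uminus Qp_in_Y latD[OF x reg] by blast
  ultimately show "x \<in> lattice_points \<Phi> P"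
    using extreme_point_iff reg by (auto simp: lattice_points_def Y_def)
qed

end

end

theorem theorem1p12:
  fixes \<Phi> :: "'a::euclidean_space set" and m :: nat and P :: "nat \<Rightarrow> 'a set" and x :: 'a
  assumes "root_system \<Phi>" and "reduced_roots \<Phi>" and "irreducible_roots \<Phi>"
    and "m \<ge> 1"
    and "\<forall>i\<in>{1..m}. special_ample_polytope \<Phi> (P i)"
    and "x \<in> lattice_points \<Phi> (\<Sum>i=1..m. P i)"
  shows "(\<exists>t\<in>lattice_tuples \<Phi> m P. (\<Sum>i=1..m. t i) = x) \<and>
    (\<forall>t\<in>lattice_tuples \<Phi> m P. \<forall>t'\<in>lattice_tuples \<Phi> m P.
       (\<Sum>i=1..m. t i) = x \<and> (\<Sum>i=1..m. t' i) = x \<longrightarrow> root_move_equiv \<Phi> m P t t')"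
proof -
  interpret root_sys \<Phi> using assms(1,2) by unfold_locales
  obtain \<mu> where mu: "\<And>i. i \<in> {1..m} \<Longrightarrow> ample_polytope_with \<Phi> (\<mu> i) (P i)"
    and dom: "\<And>i. i \<in> {1..m} \<Longrightarrow> \<forall>\<sigma>\<in>weyl_chambers \<Phi>. chamber_dominant \<Phi> \<sigma> (\<mu> i \<sigma>)"
    using assms(5) unfolding special_ample_polytope_def by metis
  interpret root_tuples \<Phi> m P "\<lambda>i h. \<mu> i (chamber h)"
    using special_family_polytope[OF mu dom] lattice_points_polytope[OF mu dom] by unfold_locales
  obtain v where xQ: "x \<in> (\<Sum>i=1..m. P i)" and v: "v extreme_point_of (\<Sum>i=1..m. P i)" "x - v \<in> Y"
    using assms(6) by (auto simp: lattice_points_def Y_def)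
  obtain p where p: "x = (\<Sum>i=1..m. p i)" "\<And>i. i \<in> {1..m} \<Longrightarrow> p i \<in> P i"
    using xQ unfolding set_sum_alt[OF finite_atLeastAtMost] by blast
  obtain s where s: "v = (\<Sum>i=1..m. s i)" "\<And>i. i \<in> {1..m} \<Longrightarrow> s i extreme_point_of P i"
    using extreme_point_of_set_sum[OF finite_atLeastAtMost v(1)] by blast
  \<comment> \<open>The decomposition \<open>p\<close> of \<open>x\<close> gives the sign
    conditions, summand by summand; the decomposition \<open>s\<close> of the extreme point
    \<open>v\<close> gives the coset.\<close>
  have "x \<in> lat sum_family"
    unfolding lat_def
  proof (intro CollectI allI impI)
    fix h assume reg: "regular h"
    have mus: "\<mu> i (chamber h) - s i \<in> Y" if i: "i \<in> {1..m}" for i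
    proof -
      obtain g where g: "regular g" "s i = \<mu> i (chamber g)"
        using s(2)[OF i] extreme_point_iff[OF mu[OF i] dom[OF i]] by blast
      show ?thesis unfolding g(2) by (rule Qp_in_Y[OF vertex_order[OF family[OF i] g(1) reg]])
    qed
    have "(\<Sum>i=1..m. \<mu> i (chamber h) - s i) - (x - v) \<in> Y"
      by (rule Y_diff[OF Y_sum[OF mus] v(2)])
    moreover have "(\<Sum>i=1..m. \<mu> i (chamber h) - s i) - (x - v) = sum_family h - x"
      unfolding s(1) sum_family_def sum_subtractf by simp
    ultimately have "sum_family h - x \<in> Y" by (simp only:)
    moreover have "0 \<le> coef h (sum_family h - x) \<alpha>" if a: "\<alpha> \<in> simple h" for \<alpha>
    proof -
      have "sum_family h - x = (\<Sum>i=1..m. \<mu> i (chamber h) - p i)"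
        using p(1) by (simp add: sum_family_def sum_subtractf)
      then have "coef h (sum_family h - x) \<alpha> = (\<Sum>i=1..m. coef h (\<mu> i (chamber h) - p i) \<alpha>)"
        by (simp only: coef_sum[OF reg])
      also have "\<dots> \<ge> 0"
      proof (rule sum_nonneg)
        fix i assume i: "i \<in> {1..m}"
        show "0 \<le> coef h (\<mu> i (chamber h) - p i) \<alpha>"
          by (rule polytope_coef_nonneg[OF mu[OF i] dom[OF i] reg p(2)[OF i] a])
      qed
      finally show ?thesis .
    qed
    ultimately show "sum_family h - x \<in> Qp h" by (simp add: Qp_def)
  qed
  show ?thesis
  proof (intro conjI ballI impI)
    show "\<exists>t\<in>tuples. (\<Sum>i=1..m. t i) = x"
      using exists_tuple[OF \<open>x \<in> lat sum_family\<close>] unfolding total_def .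
  next
    fix t t' assume "t \<in> tuples" "t' \<in> tuples" "(\<Sum>i=1..m. t i) = x \<and> (\<Sum>i=1..m. t' i) = x"
    then show "root_move_equiv \<Phi> m P t t'" by (intro equivalent_if_total_eq) (simp_all only: total_def)
  qed
qed

end
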